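(* Assume that MSCQ holds for the system $G(z)\in K$ at $\bar z$. Let - $z^*\in N_{\operatorname{gph}\Gamma}(\bar z)$ with $\pi_{X^*}(z^* )=\bar x^*$, - $v=(q,u)\in{\cal K}_{\operatorname{gph}\Gamma}(\bar z,z^* )$, - $\hat\mu\in{\cal M}(\bar z,z^*;v)$, - $w^*_{x^*}\in X^*$ be such that there is a sequence $w^*_k\in{\cal K}_{\operatorname{gph}\Gamma}(\bar z,z^* )^*$ with $w^*_{x^*}=\lim_k\pi_{X^*}(w^*_k)$ and $\lim_k\langle w_k^*,v\rangle=0$. Then $$\big(q,u,\nabla(\nabla_xG(\cdot)^*\hat\mu)(\bar z)v+w^*_{x^*}\big)\in T_{\operatorname{gph}\Psi}(\bar p,\bar x,\bar x^* ),$$ and this tangent vector is derivable. In particular, for all such $z^*,v=(q,u),\hat\mu$, $$\big(q,u,\nabla(\nabla_xG(\cdot)^*\hat\mu)(\bar z)v+\pi_{X^*}(w^* )\big)\in T_{\operatorname{gph}\Psi}(\bar p,\bar x,\bar x^* )\quad\text{for all } w^*\in N_{{\cal K}_{\operatorname{gph}\Gamma}(\bar z,z^* )}(v).$$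
   Context: Notation: $X=\mathbb R^n$, $P=\mathbb R^m$, $Y=\mathbb R^l$, $Z:=P\times X$, and $E$ is finite-dimensional. Dual spaces are distinguished from primal ones, $Z^*=P^*\times X^*$, and $\pi_{X^*}(p^*,x^* ):=x^*$. $A^*$ denotes the adjoint of a linear map $A$. For $\mu\in E^*$, $\nabla(\nabla_xG(\cdot)^*\mu)(\bar z)v\in X^*$ is the derivative at $\bar z$ of the map $z\mapsto\nabla_xG(z)^*\mu$, applied to $v$. For a cone $A$, $A^*:=\{a^*:\langle a^*,a\rangle\le0\ \forall a\in A\}$ is its polar. For a closed set $\Omega$ and $\bar z\in\Omega$: the tangent cone is $T_\Omega(\bar z):=\{w:\exists\, t_k\downarrow0,\ w_k\to w \text{ with } \bar z+t_kw_k\in\Omega\}$; the regular normal cone is $N_\Omega(\bar z):=\{z^*:\limsup_{z\to\bar z,\,z\in\Omega}\langle z^*,z-\bar z\rangle/\|z-\bar z\|\le0\}$; and, for $z^*\in N_\Omega(\bar z)$, the critical cone is ${\cal K}_\Omega(\bar z,z^* ):=T_\Omega(\bar z)\cap\{z^*\}^\perp$. A tangent vector $w\in T_\Omega(\bar z)$ is derivable if there is $\xi\colon[0,\varepsilon]\to\Omega$ with $\xi(0)=\bar z$ and right derivative $\xi'_+(0)=w$. Setting: $g\colon P\times X\to Y$ is $C^2$ around $\bar z=(\bar p,\bar x)$. The set $C\subset Y$ is closed and $C^2$-cone reducible at $g(\bar z)$ to a closed convex cone $K\subset E$: there exist a neighborhood $V$ of $g(\bar z)$ and a $C^2$ map $h\colon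 V\to E$ with $h(g(\bar z))=0$, $\nabla h(g(\bar z))$ surjective, and $C\cap V=\{y\in V:h(y)\in K\}$. Set $\Gamma(p):=\{x:g(p,x)\in C\}$ with $\bar x\in\Gamma(\bar p)$, $\Psi(p,x):=N_{\Gamma(p)}(x)$, and fix $\bar x^*\in N_{\Gamma(\bar p)}(\bar x)$. Let $G:=h\circ g$, defined near $\bar z$, so that $G(\bar z)=0$. Near $\bar z$, $\operatorname{gph}\Gamma$ coincides with $\{z:G(z)\in K\}$, and for $p$ near $\bar p$, $\Gamma(p)$ coincides near $\bar x$ with $\{x:G(p,x)\in K\}$. The system $G(z)\in K$ satisfies MSCQ at $\bar z$ if there is $\kappa\ge0$ such that ${\rm dist}(z;G^{-1}(K))\le\kappa\,{\rm dist}(G(z);K)$ for all $z$ near $\bar z$. Multiplier sets: for $z^*\in N_{\operatorname{gph}\Gamma}(\bar z)$, ${\cal M}(\bar z,z^* ):=\{\mu\in K^*:\nabla G(\bar z)^*\mu=z^*\}$, and for $v\in{\cal K}_{\operatorname{gph}\Gamma}(\bar z,z^* )$, ${\cal M}(\bar z,z^*;v):=\arg\max\{\langle\mu,\nabla^2G(\bar z)(v,v)\rangle:\mu\in{\cal M}(\bar z,z^* )\}$. *)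

theory Defs
  imports "HOL-Analysis.Analysis"
begin

text \<open>Duals of Euclidean spaces are identified with the spaces themselves via the inner product.\<close>

definition tangent_cone :: "'a::real_normed_vector set \<Rightarrow> 'a \<Rightarrow> 'a set" where
  "tangent_cone \<Omega> zb = {w. \<exists>(t::nat \<Rightarrow> real) (wk::nat \<Rightarrow> 'a).
      (\<forall>k. t k > 0) \<and> t \<longlonglongrightarrow> 0 \<and> wk \<longlonglongrightarrow> w \<and> (\<forall>k. zb + t k *\<^sub>R wk k \<in> \<Omega>)}"

text \<open>Regular (Frechet) normal cone; empty at points outside the set.
  The condition limsup_{z -> zb, z in Omega} <z*, z - zb>/|z - zb| <= 0 is written in epsilon-delta form.\<close>
definition regular_normal_cone :: "'a::real_inner set \<Rightarrow> 'a \<Rightarrow> 'a set" where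
  "regular_normal_cone \<Omega> zb = {zs. zb \<in> \<Omega> \<and>
      (\<forall>\<epsilon>>0. \<exists>\<delta>>0. \<forall>z\<in>\<Omega>. 0 < norm (z - zb) \<and> norm (z - zb) < \<delta> \<longrightarrow>
           inner zs (z - zb) \<le> \<epsilon> * norm (z - zb))}"

definition polar_cone :: "'a::real_inner set \<Rightarrow> 'a set" where
  "polar_cone A = {as. \<forall>a\<in>A. inner as a \<le> 0}"

definition critical_cone :: "'a::real_inner set \<Rightarrow> 'a \<Rightarrow> 'a \<Rightarrow> 'a set" where
  "critical_cone \<Omega> zb zs = {w \<in> tangent_cone \<Omega> zb. inner zs w = 0}"

definition derivable_tangent :: "'a::real_normed_vector set \<Rightarrow> 'a \<Rightarrow> 'a \<Rightarrow> bool" where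
  "derivable_tangent \<Omega> zb w \<longleftrightarrow> w \<in> tangent_cone \<Omega> zb \<and>
     (\<exists>\<epsilon>>0. \<exists>\<xi>::real \<Rightarrow> 'a. (\<forall>t\<in>{0..\<epsilon>}. \<xi> t \<in> \<Omega>) \<and> \<xi> 0 = zb \<and>
         (\<xi> has_vector_derivative w) (at 0 within {0..\<epsilon>}))"

definition C2_on :: "'a::euclidean_space set \<Rightarrow> ('a \<Rightarrow> 'b::euclidean_space) \<Rightarrow> bool" where
  "C2_on U f \<longleftrightarrow> open U \<and> (\<exists>(f' :: 'a \<Rightarrow> 'a \<Rightarrow>\<^sub>L 'b) (f'' :: 'a \<Rightarrow> 'a \<Rightarrow>\<^sub>L 'a \<Rightarrow>\<^sub>L 'b).
      (\<forall>z\<in>U. (f has_derivative blinfun_apply (f' z)) (at z)) \<and>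
      (\<forall>z\<in>U. (f' has_derivative blinfun_apply (f'' z)) (at z)) \<and>
      continuous_on U f'')"

definition gph_Gamma :: "('p \<times> 'x \<Rightarrow> 'y) \<Rightarrow> 'y set \<Rightarrow> ('p \<times> 'x) set" where
  "gph_Gamma g C = {(p, x). g (p, x) \<in> C}"

definition Gam :: "('p \<times> 'x \<Rightarrow> 'y) \<Rightarrow> 'y set \<Rightarrow> 'p \<Rightarrow> 'x set" where
  "Gam g C p = {x. g (p, x) \<in> C}"

definition gph_Psi :: "('p \<times> 'x::real_inner \<Rightarrow> 'y) \<Rightarrow> 'y set \<Rightarrow> (('p \<times> 'x) \<times> 'x) set" where
  "gph_Psi g C = {((p, x), xs). xs \<in> regular_normal_cone (Gam g C p) x}"

text \<open>Multiplier sets, with DG the derivative of G at zb and D2G its second derivative at zb.\<close>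
definition mult_set :: "('z::euclidean_space \<Rightarrow>\<^sub>L 'e::euclidean_space) \<Rightarrow> 'e set \<Rightarrow> 'z \<Rightarrow> 'e set" where
  "mult_set DG K zs = {\<mu> \<in> polar_cone K. adjoint (blinfun_apply DG) \<mu> = zs}"

definition mult_set_dir :: "('z::euclidean_space \<Rightarrow>\<^sub>L 'e::euclidean_space) \<Rightarrow> ('z \<Rightarrow>\<^sub>L 'z \<Rightarrow>\<^sub>L 'e)
      \<Rightarrow> 'e set \<Rightarrow> 'z \<Rightarrow> 'z \<Rightarrow> 'e set" where
  "mult_set_dir DG D2G K zs v = {\<mu> \<in> mult_set DG K zs.
      \<forall>\<nu>\<in>mult_set DG K zs. inner \<nu> (D2G v v) \<le> inner \<mu> (D2G v v)}"

definition MSCQ :: "('z::euclidean_space \<Rightarrow> 'e::euclidean_space) \<Rightarrow> 'e set \<Rightarrow> 'z \<Rightarrow> bool" where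
  "MSCQ G K zb \<longleftrightarrow> (\<exists>\<kappa>\<ge>0. \<exists>\<delta>>0. \<forall>z. dist z zb < \<delta> \<longrightarrow>
      infdist z {z'. G z' \<in> K} \<le> \<kappa> * infdist (G z) K)"

end

theory Submission
  imports Defs
begin

text \<open>
  Put \<open>H = \<langle>\<mu>, D\<^sup>2G\<rangle>\<close>, \<open>\<Omega> = gph \<Gamma>\<close> and, for \<open>n\<close> polar to the critical cone and small \<open>t > 0\<close>, minimise
  \<open>- \<langle>z* + t (H v + n), z - zb\<rangle> + \<rho>/2 \<parallel>z - zb - t v\<parallel>\<^sup>2\<close> over \<open>\<Omega>\<close> near \<open>zb\<close>, with \<open>\<rho>\<close> larger than the
  norm of \<open>H\<close>. Optimality makes \<open>z* + t (H v + n) - \<rho> (z - zb - t v)\<close> a regular normal at the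
  minimiser, whose \<open>X\<close>-component belongs to \<open>gph \<Psi>\<close>; it remains to see that the minimiser is
  \<open>zb + t v + o(t)\<close>, up to an error governed by \<open>\<langle>n, v\<rangle>\<close>. From below, \<open>\<langle>\<mu>, G z\<rangle> \<le> 0\<close> on \<open>\<Omega>\<close> bounds
  \<open>- \<langle>z*, z - zb\<rangle>\<close> by \<open>H/2\<close>. From above, linear conic duality (exact after penalisation with the
  MSCQ modulus) and MSCQ yield points \<open>zb + t v + O(t\<^sup>2)\<close> of \<open>\<Omega>\<close> where this bound is attained up to
  \<open>o(t\<^sup>2)\<close>, precisely because \<open>\<mu>\<close> maximises \<open>\<langle>\<mu>, D\<^sup>2G v v\<rangle>\<close> over the multipliers.
\<close>

subsection \<open>Second-order differentiation\<close>

lemma blinfun_derivative_remainder: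
  fixes f' :: "'a::real_normed_vector \<Rightarrow> 'a \<Rightarrow>\<^sub>L 'b::real_normed_vector"
  assumes "(f' has_derivative blinfun_apply f'') (at a)" and "e > 0"
  obtains \<delta> where "\<delta> > 0" "\<And>k. norm k < \<delta> \<Longrightarrow> norm (f' (a + k) - f' a - f'' k) \<le> e * norm k"
proof -
  obtain \<delta> where "\<delta> > 0" and \<delta>: "\<And>y. norm (y - a) < \<delta> \<Longrightarrow> norm (f' y - f' a - f'' (y - a)) \<le> e * norm (y - a)"
    using assms unfolding has_derivative_at_alt by blast
  show thesis
    using that[OF \<open>\<delta> > 0\<close>] \<delta>[of "a + k" for k] by simp
qed

text \<open>Twice differentiability at the single point \<open>a\<close> suffices: the mixed difference
  \<open>f (a + tx + ty) - f (a + tx) - f (a + ty) + f a\<close> is symmetric in \<open>x\<close>, \<open>y\<close> and equals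
  \<open>t\<^sup>2 f'' x y + o(t\<^sup>2)\<close>.\<close>
lemma second_derivative_symmetric:
  fixes f :: "'a::real_normed_vector \<Rightarrow> 'b::real_normed_vector"
  assumes "open W" "a \<in> W"
    and f: "\<And>z. z \<in> W \<Longrightarrow> (f has_derivative blinfun_apply (f' z)) (at z)"
    and f': "(f' has_derivative blinfun_apply f'') (at a)"
  shows "blinfun_apply (blinfun_apply f'' x) y = blinfun_apply (blinfun_apply f'' y) x"
proof -
  obtain r where "r > 0" and r: "ball a r \<subseteq> W"
    using assms(1,2) openE by blast
  define S where "S t x y = f (a + t *\<^sub>R x + t *\<^sub>R y) - f (a + t *\<^sub>R x) - f (a + t *\<^sub>R y) + f a"
    for t :: real and x y
  have mixed: "\<exists>\<tau>>0. \<forall>t. 0 < t \<and> t < \<tau> \<longrightarrow>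
      norm (S t x y - (t * t) *\<^sub>R f'' x y) \<le> e * (t * t) * (norm x + 2 * norm y) * norm y"
    if "e > 0" for e x y
  proof -
    obtain d where "d > 0" and d: "\<And>k. norm k < d \<Longrightarrow> norm (f' (a + k) - f' a - f'' k) \<le> e * norm k"
      using blinfun_derivative_remainder[OF f' \<open>e > 0\<close>] by blast
    define m where "m = min r d"
    have "m > 0" using \<open>r > 0\<close> \<open>d > 0\<close> by (simp add: m_def)
    define c where "c = norm x + norm y + 1"
    have "c > 0" by (simp add: c_def add_nonneg_pos)
    have "norm (S t x y - (t * t) *\<^sub>R f'' x y) \<le> e * (t * t) * (norm x + 2 * norm y) * norm y"
      if t: "0 < t" "t < m / c" for t
    proof -
      \<comment> \<open>Subtracting the linear term makes the derivative of \<open>\<psi>\<close> at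
        \<open>k\<close> the difference of the remainders of \<open>f'\<close> at the increments
        \<open>t *\<^sub>R x + k\<close> and \<open>k\<close>. The mean value inequality from
        \<open>0\<close> to \<open>t *\<^sub>R y\<close> then bounds the mixed difference;
        \<open>B\<close> adds up the two remainder bounds.\<close>
      define \<psi> where "\<psi> k = f (a + t *\<^sub>R x + k) - f (a + k) - t *\<^sub>R f'' x k" for k
      define B where "B = e * (t * norm x + 2 * (t * norm y))"
      have tc: "t * norm x + t * norm y + t < m"
        using t \<open>c > 0\<close> by (simp add: c_def pos_less_divide_eq algebra_simps)
      have small: "norm (t *\<^sub>R x + k) < m" "norm k < m" if "k \<in> cball 0 (t * norm y)" for k
      proof -
        have "norm (t *\<^sub>R x + k) \<le> t * norm x + norm k"
          using norm_triangle_ineq[of "t *\<^sub>R x" k] t by simp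
        then show "norm (t *\<^sub>R x + k) < m" using that tc t by auto
        have "0 \<le> t * norm x" using t by simp
        then show "norm k < m" using that tc t unfolding mem_cball_0 by linarith
      qed
      have inW: "a + t *\<^sub>R x + k \<in> W" "a + k \<in> W" if "k \<in> cball 0 (t * norm y)" for k
        using small[OF that] norm_minus_cancel[of "t *\<^sub>R x + k"]
        by (auto intro!: subsetD[OF r] simp: m_def dist_norm add.assoc norm_minus_commute)
      have der: "(\<psi> has_derivative blinfun_apply (f' (a + t *\<^sub>R x + k) - f' (a + k) - t *\<^sub>R f'' x))
          (at k within cball 0 (t * norm y))" if k: "k \<in> cball 0 (t * norm y)" for k
      proof -
        have 1: "((\<lambda>k. f (a + t *\<^sub>R x + k)) has_derivative blinfun_apply (f' (a + t *\<^sub>R x + k))) (at k)"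
          by (rule has_derivative_compose[of "\<lambda>k. a + t *\<^sub>R x + k" "\<lambda>k. k", OF _ f[OF inW(1)[OF k]]])
            (auto intro!: derivative_eq_intros)
        have 2: "((\<lambda>k. f (a + k)) has_derivative blinfun_apply (f' (a + k))) (at k)"
          by (rule has_derivative_compose[of "\<lambda>k. a + k" "\<lambda>k. k", OF _ f[OF inW(2)[OF k]]])
            (auto intro!: derivative_eq_intros)
        show ?thesis
          unfolding \<psi>_def
          by (rule has_derivative_at_withinI)
            (rule 1 2 derivative_eq_intros refl | (rule ext, simp add: blinfun.bilinear_simps))+
      qed
      have bnd: "onorm (blinfun_apply (f' (a + t *\<^sub>R x + k) - f' (a + k) - t *\<^sub>R f'' x)) \<le> B"
        if k: "k \<in> cball 0 (t * norm y)" for k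
      proof -
        have e1: "norm (f' (a + (t *\<^sub>R x + k)) - f' a - f'' (t *\<^sub>R x + k)) \<le> e * norm (t *\<^sub>R x + k)"
          and e2: "norm (f' (a + k) - f' a - f'' k) \<le> e * norm k"
          using d small[OF k] by (simp_all add: m_def)
        have "f' (a + t *\<^sub>R x + k) - f' (a + k) - t *\<^sub>R f'' x
          = (f' (a + (t *\<^sub>R x + k)) - f' a - f'' (t *\<^sub>R x + k)) - (f' (a + k) - f' a - f'' k)"
          by (simp add: blinfun.bilinear_simps add.assoc)
        then have "norm (f' (a + t *\<^sub>R x + k) - f' (a + k) - t *\<^sub>R f'' x)
            \<le> e * norm (t *\<^sub>R x + k) + e * norm k"
          using norm_triangle_ineq4 e1 e2 by (smt (verit))
        also have "\<dots> \<le> e * (t * norm x + norm k) + e * norm k"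
          using norm_triangle_ineq[of "t *\<^sub>R x" k] t \<open>e > 0\<close> by simp
        also have "\<dots> \<le> B"
          using k \<open>e > 0\<close> by (simp add: B_def distrib_left[symmetric])
        finally show ?thesis by (simp add: norm_blinfun.rep_eq)
      qed
      have "norm (\<psi> (t *\<^sub>R y) - \<psi> 0) \<le> B * norm (t *\<^sub>R y - 0)"
        by (rule differentiable_bound[OF convex_cball der bnd]) (use t in auto)
      moreover have "\<psi> (t *\<^sub>R y) - \<psi> 0 = S t x y - (t * t) *\<^sub>R f'' x y"
        by (simp add: \<psi>_def S_def blinfun.bilinear_simps)
      ultimately show ?thesis
        using t by (simp add: B_def algebra_simps)
    qed
    then show ?thesis using \<open>m > 0\<close> \<open>c > 0\<close> by (intro exI[of _ "m / c"]) auto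
  qed
  have bound: "norm (f'' x y - f'' y x) \<le> e * ((norm x + 2 * norm y) * norm y + (norm y + 2 * norm x) * norm x)"
    if e: "e > 0" for e
  proof -
    obtain \<tau> where "\<tau> > 0" and \<tau>: "\<And>t. 0 < t \<Longrightarrow> t < \<tau> \<Longrightarrow>
        norm (S t x y - (t * t) *\<^sub>R f'' x y) \<le> e * (t * t) * (norm x + 2 * norm y) * norm y"
      using mixed[OF e, of x y] by blast
    obtain \<sigma> where "\<sigma> > 0" and \<sigma>: "\<And>t. 0 < t \<Longrightarrow> t < \<sigma> \<Longrightarrow>
        norm (S t y x - (t * t) *\<^sub>R f'' y x) \<le> e * (t * t) * (norm y + 2 * norm x) * norm x"
      using mixed[OF e, of y x] by blast
    define t where "t = min \<tau> \<sigma> / 2"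
    have t: "0 < t" "t < \<tau>" "t < \<sigma>" using \<open>\<tau> > 0\<close> \<open>\<sigma> > 0\<close> by (auto simp: t_def)
    have split: "(t * t) *\<^sub>R (f'' x y - f'' y x)
        = (S t y x - (t * t) *\<^sub>R f'' y x) - (S t x y - (t * t) *\<^sub>R f'' x y)"
      by (simp add: S_def algebra_simps)
    have "norm ((t * t) *\<^sub>R (f'' x y - f'' y x))
        \<le> e * (t * t) * (norm y + 2 * norm x) * norm x + e * (t * t) * (norm x + 2 * norm y) * norm y"
      using split norm_triangle_ineq4 \<tau>[OF t(1,2)] \<sigma>[OF t(1,3)] by (smt (verit))
    also have "\<dots> = (t * t) * (e * ((norm x + 2 * norm y) * norm y + (norm y + 2 * norm x) * norm x))"
      by algebra
    finally have "(t * t) * norm (f'' x y - f'' y x)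
        \<le> (t * t) * (e * ((norm x + 2 * norm y) * norm y + (norm y + 2 * norm x) * norm x))"
      by simp
    then show ?thesis using t by simp
  qed
  have "norm (f'' x y - f'' y x) \<le> 0"
  proof (rule field_le_epsilon)
    fix e :: real assume "e > 0"
    define c where "c = (norm x + 2 * norm y) * norm y + (norm y + 2 * norm x) * norm x"
    have "c \<ge> 0" by (simp add: c_def)
    have ec: "e / (c + 1) > 0" using \<open>e > 0\<close> \<open>c \<ge> 0\<close> by simp
    have "norm (f'' x y - f'' y x) \<le> (e / (c + 1)) * c"
      using bound[OF ec] by (simp only: c_def)
    also have "\<dots> \<le> 0 + e" using \<open>e > 0\<close> \<open>c \<ge> 0\<close> by (simp add: field_simps)
    finally show "norm (f'' x y - f'' y x) \<le> 0 + e" .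
  qed
  then show ?thesis by simp
qed

text \<open>Mean value inequality for \<open>f (a + k)\<close> minus its quadratic model. By
  symmetry of \<open>f''\<close> the model has derivative \<open>f' a + f'' j\<close> at
  \<open>j\<close>, so what has to be bounded is the first-order remainder of \<open>f'\<close> at
  \<open>a\<close>.\<close>

lemma second_order_expansion:
  fixes f :: "'a::real_normed_vector \<Rightarrow> 'b::real_normed_vector"
  assumes W: "open W" "a \<in> W"
    and f: "\<And>z. z \<in> W \<Longrightarrow> (f has_derivative blinfun_apply (f' z)) (at z)"
    and f': "(f' has_derivative blinfun_apply f'') (at a)"
    and "e > 0"
  obtains \<delta> where "\<delta> > 0"
    "\<And>k. norm k < \<delta> \<Longrightarrow> norm (f (a + k) - f a - f' a k - (1/2) *\<^sub>R f'' k k) \<le> e * (norm k)\<^sup>2"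
proof -
  obtain r where "r > 0" and r: "ball a r \<subseteq> W"
    using W openE by blast
  obtain d where "d > 0" and d: "\<And>k. norm k < d \<Longrightarrow> norm (f' (a + k) - f' a - f'' k) \<le> e * norm k"
    using blinfun_derivative_remainder[OF f' \<open>e > 0\<close>] by blast
  define m where "m = min r d"
  show thesis
  proof (rule that[of m])
    show "m > 0" using \<open>r > 0\<close> \<open>d > 0\<close> by (simp add: m_def)
    fix k :: 'a assume k: "norm k < m"
    define \<psi> where "\<psi> k = f (a + k) - f' a k - (1/2) *\<^sub>R f'' k k" for k
    have der: "(\<psi> has_derivative blinfun_apply (f' (a + j) - f' a - f'' j)) (at j within cball 0 (norm k))"
      if j: "j \<in> cball 0 (norm k)" for j
    proof -
      have "a + j \<in> W" using j k r by (auto simp: m_def dist_norm)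
      then have aj: "(f has_derivative blinfun_apply (f' (a + j))) (at (a + j))" by (rule f)
      have 1: "((\<lambda>k. f (a + k)) has_derivative blinfun_apply (f' (a + j))) (at j)"
        by (rule has_derivative_compose[of "\<lambda>k. a + k" "\<lambda>k. k", OF _ aj])
            (auto intro!: derivative_eq_intros)
      show ?thesis
        unfolding \<psi>_def
        by (rule has_derivative_at_withinI)
          (rule 1 derivative_eq_intros refl
            | (rule ext, simp add: blinfun.bilinear_simps second_derivative_symmetric[OF W f f', of _ j]
                scaleR_left_distrib[symmetric] scaleR_right_distrib[symmetric]))+
    qed
    have bnd: "onorm (blinfun_apply (f' (a + j) - f' a - f'' j)) \<le> e * norm k"
      if j: "j \<in> cball 0 (norm k)" for j
    proof -
      have "norm (f' (a + j) - f' a - f'' j) \<le> e * norm j"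
        using d j k by (simp add: m_def)
      also have "\<dots> \<le> e * norm k" using j \<open>e > 0\<close> by simp
      finally show ?thesis by (simp add: norm_blinfun.rep_eq)
    qed
    have "norm (\<psi> k - \<psi> 0) \<le> e * norm k * norm (k - 0)"
      by (rule differentiable_bound[OF convex_cball der bnd]) auto
    then show "norm (f (a + k) - f a - f' a k - (1/2) *\<^sub>R f'' k k) \<le> e * (norm k)\<^sup>2"
      by (simp add: \<psi>_def blinfun.bilinear_simps power2_eq_square algebra_simps)
  qed
qed

subsection \<open>Tangents, normals and conic duality\<close>

lemma infdist_lessE:
  assumes "infdist x A < c" "A \<noteq> {}"
  obtains a where "a \<in> A" "dist x a < c"
  using cInf_lessD[of "dist x ` A" c] assms by (auto simp: infdist_notempty)

text \<open>Derivability concerns the right derivative at \<open>0\<close> alone, so a curve may be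
  selected pointwise in \<open>t\<close>. One selection has to serve every \<open>e\<close>, hence
  near-best approximants of \<open>a + t *\<^sub>R w\<close>; the slack \<open>t\<^sup>2\<close>
  replaces attainment of the distance and is of smaller order than \<open>t\<close>.\<close>

lemma derivable_tangentI:
  fixes \<Omega> :: "'a::real_normed_vector set"
  assumes "a \<in> \<Omega>"
    and near: "\<And>e. e > 0 \<Longrightarrow> \<exists>\<delta>>0. \<forall>t. 0 < t \<and> t < \<delta> \<longrightarrow> (\<exists>y\<in>\<Omega>. norm (y - a - t *\<^sub>R w) \<le> e * t)"
  shows "derivable_tangent \<Omega> a w"
proof -
  have ne: "\<Omega> \<noteq> {}" using assms(1) by auto
  have "\<exists>y. y \<in> \<Omega> \<and> (t > 0 \<longrightarrow> norm (y - a - t *\<^sub>R w) \<le> infdist (a + t *\<^sub>R w) \<Omega> + t\<^sup>2) \<and> (t = 0 \<longrightarrow> y = a)" for t :: real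
  proof (cases "t > 0")
    case True
    then have "infdist (a + t *\<^sub>R w) \<Omega> < infdist (a + t *\<^sub>R w) \<Omega> + t\<^sup>2" by simp
    then obtain y where "y \<in> \<Omega>" "dist (a + t *\<^sub>R w) y < infdist (a + t *\<^sub>R w) \<Omega> + t\<^sup>2"
      using ne by (rule infdist_lessE)
    then show ?thesis using True
      by (intro exI[of _ y]) (auto simp: dist_norm norm_minus_commute algebra_simps)
  qed (use assms(1) in auto)
  then obtain \<xi> where \<xi>: "\<And>t. \<xi> t \<in> \<Omega>"
    "\<And>t. t > 0 \<Longrightarrow> norm (\<xi> t - a - t *\<^sub>R w) \<le> infdist (a + t *\<^sub>R w) \<Omega> + t\<^sup>2" "\<xi> 0 = a"
    by metis
  have approx: "\<exists>\<delta>>0. \<forall>t. 0 < t \<and> t < \<delta> \<longrightarrow> norm (\<xi> t - a - t *\<^sub>R w) \<le> e * t" if "e > 0" for e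
  proof -
    obtain \<delta> where "\<delta> > 0" and \<delta>: "\<forall>t. 0 < t \<and> t < \<delta> \<longrightarrow> (\<exists>y\<in>\<Omega>. norm (y - a - t *\<^sub>R w) \<le> (e/2) * t)"
      using near[of "e/2"] \<open>e > 0\<close> by auto
    have "norm (\<xi> t - a - t *\<^sub>R w) \<le> e * t" if t: "0 < t" "t < min \<delta> (e/2)" for t
    proof -
      obtain y where "y \<in> \<Omega>" "norm (y - a - t *\<^sub>R w) \<le> (e/2) * t" using \<delta> t by auto
      then have "infdist (a + t *\<^sub>R w) \<Omega> \<le> (e/2) * t"
        by (intro infdist_le2[of y]) (auto simp: dist_norm norm_minus_commute algebra_simps)
      moreover have "t\<^sup>2 \<le> (e/2) * t" using t by (simp add: power2_eq_square)
      ultimately show ?thesis using \<xi>(2)[OF t(1)] by (simp add: algebra_simps)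
    qed
    then show ?thesis using \<open>\<delta> > 0\<close> \<open>e > 0\<close> by (intro exI[of _ "min \<delta> (e/2)"]) auto
  qed
  have der: "(\<xi> has_vector_derivative w) (at 0 within {0..1})"
    unfolding has_vector_derivative_def has_derivative_within_alt
  proof (intro conjI allI impI)
    show "bounded_linear (\<lambda>x. x *\<^sub>R w)" by (rule bounded_linear_scaleR_left)
    fix e :: real assume "e > 0"
    then obtain \<delta> where "\<delta> > 0" "\<And>t. 0 < t \<Longrightarrow> t < \<delta> \<Longrightarrow> norm (\<xi> t - a - t *\<^sub>R w) \<le> e * t"
      using approx by blast
    then show "\<exists>d>0. \<forall>y\<in>{0..1}. norm (y - 0) < d \<longrightarrow>
        norm (\<xi> y - \<xi> 0 - (y - 0) *\<^sub>R w) \<le> e * norm (y - 0)"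
      using \<xi>(3) by (intro exI[of _ \<delta>]) (auto, metis diff_zero diff_self eq_iff_diff_eq_0 less_eq_real_def mult_zero_right norm_zero scale_zero_left)
  qed
  define t where "t k = inverse (real (Suc k))" for k
  have t0: "t \<longlonglongrightarrow> 0" unfolding t_def by (rule LIMSEQ_inverse_real_of_nat)
  have tpos: "t k > 0" for k by (simp add: t_def)
  define wk where "wk k = inverse (t k) *\<^sub>R (\<xi> (t k) - a)" for k
  have "wk \<longlonglongrightarrow> w"
  proof (rule LIMSEQ_I)
    fix e :: real assume "e > 0"
    then obtain \<delta> where "\<delta> > 0" and \<delta>: "\<And>t. 0 < t \<Longrightarrow> t < \<delta> \<Longrightarrow> norm (\<xi> t - a - t *\<^sub>R w) \<le> (e/2) * t"
      using approx[of "e/2"] by auto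
    obtain N where N: "\<And>k. k \<ge> N \<Longrightarrow> t k < \<delta>"
      using LIMSEQ_D[OF t0 \<open>\<delta> > 0\<close>] tpos by (auto simp: abs_of_pos)
    have "norm (wk k - w) < e" if "k \<ge> N" for k
    proof -
      have "wk k - w = inverse (t k) *\<^sub>R (\<xi> (t k) - a - t k *\<^sub>R w)"
        using tpos[of k] by (simp add: wk_def scaleR_diff_right)
      then have "norm (wk k - w) = norm (\<xi> (t k) - a - t k *\<^sub>R w) / t k"
        using tpos[of k] by (simp add: divide_inverse)
      also have "\<dots> \<le> e/2" using \<delta>[OF tpos N[OF that]] tpos[of k] by (simp add: pos_divide_le_eq)
      finally show ?thesis using \<open>e > 0\<close> by simp
    qed
    then show "\<exists>N. \<forall>k\<ge>N. norm (wk k - w) < e" by blast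
  qed
  moreover have "a + t k *\<^sub>R wk k \<in> \<Omega>" for k
    using \<xi>(1)[of "t k"] tpos[of k] by (simp add: wk_def)
  ultimately have "w \<in> tangent_cone \<Omega> a"
    unfolding tangent_cone_def using t0 tpos by blast
  then show ?thesis
    unfolding derivable_tangent_def using der \<xi>(1,3)
    by (intro conjI exI[of _ "1::real"] exI[of _ \<xi>]) auto
qed

text \<open>Fermat's rule: after expanding the squares around \<open>z\<close>, minimality says that
  the candidate normal pairs with \<open>x - z\<close> to at most
  \<open>\<rho> / 2 * (norm (x - z))\<^sup>2\<close>, which is of smaller order than
  \<open>norm (x - z)\<close>.\<close>

lemma regular_normal_of_local_min:
  fixes a y z :: "'a::real_inner"
  assumes "z \<in> \<Omega>" "\<delta> > 0" "\<rho> \<ge> 0"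
    and min: "\<And>x. x \<in> \<Omega> \<Longrightarrow> norm (x - z) < \<delta> \<Longrightarrow>
      \<rho> / 2 * (norm (z - y))\<^sup>2 - inner a z \<le> \<rho> / 2 * (norm (x - y))\<^sup>2 - inner a x"
  shows "a - \<rho> *\<^sub>R (z - y) \<in> regular_normal_cone \<Omega> z"
proof -
  have quad: "inner (a - \<rho> *\<^sub>R (z - y)) (x - z) \<le> \<rho> / 2 * (norm (x - z))\<^sup>2"
    if "x \<in> \<Omega>" "norm (x - z) < \<delta>" for x
    using min[OF that] unfolding power2_norm_eq_inner
    by (simp add: inner_simps inner_commute algebra_simps)
  show ?thesis
    unfolding regular_normal_cone_def
  proof (intro CollectI conjI allI impI)
    fix e :: real assume "e > 0"
    define d where "d = min \<delta> (e / (\<rho> + 1))"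
    have "d > 0" using assms \<open>e > 0\<close> by (simp add: d_def)
    moreover have "inner (a - \<rho> *\<^sub>R (z - y)) (x - z) \<le> e * norm (x - z)"
      if "x \<in> \<Omega>" "norm (x - z) < d" for x
    proof -
      have "(\<rho> + 1) * norm (x - z) < e"
        using that assms(3) by (simp add: d_def pos_less_divide_eq mult.commute)
      moreover have "0 \<le> \<rho> * norm (x - z)" using assms(3) by simp
      ultimately have "\<rho> / 2 * norm (x - z) \<le> e"
        using norm_ge_zero[of "x - z"] \<open>e > 0\<close> by (simp only: distrib_right)
      then have "\<rho> / 2 * norm (x - z) * norm (x - z) \<le> e * norm (x - z)"
        by (rule mult_right_mono) simp
      then show ?thesis using quad[of x] that by (simp add: d_def power2_eq_square)
    qed
    ultimately show "\<exists>\<delta>>0. \<forall>x\<in>\<Omega>. 0 < norm (x - z) \<and> norm (x - z) < \<delta> \<longrightarrow>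
        inner (a - \<rho> *\<^sub>R (z - y)) (x - z) \<le> e * norm (x - z)" by blast
  qed (fact assms(1))
qed

text \<open>Moreau decomposition: the residual of the projection onto a closed convex cone is polar
  to the cone and orthogonal to the projection, so its normalisation recovers the distance.\<close>

lemma infdist_cone_polar:
  fixes K :: "'e::euclidean_space set"
  assumes K: "closed K" "convex K" "cone K" "0 \<in> K"
  obtains \<mu> where "\<mu> \<in> polar_cone K" "norm \<mu> \<le> 1" "inner \<mu> y = infdist y K"
proof -
  define p where "p = closest_point K y"
  define r where "r = y - p"
  have ne: "K \<noteq> {}" using K(4) by auto
  have pK: "p \<in> K" unfolding p_def by (rule closest_point_in_set[OF K(1) ne])
  have dist: "infdist y K = norm r"
    using infdist_attains_inf[OF K(1) ne, of y] closest_point_le[OF K(1), of _ y] pK infdist_le[OF pK, of y]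
    by (metis dist_norm order_antisym p_def r_def)
  have le: "inner r (x - p) \<le> 0" if "x \<in> K" for x
    unfolding r_def p_def by (rule closest_point_dot[OF K(2,1) that])
  \<comment> \<open>Testing the variational inequality at \<open>2 *\<^sub>R p\<close> and at
    \<open>0\<close> bounds \<open>inner r p\<close> from both sides.\<close>
  have "2 *\<^sub>R p \<in> K" using K(3) pK by (simp add: cone_def)
  then have "inner r p = 0" using le[of "2 *\<^sub>R p"] le[OF K(4)] by (simp add: inner_diff_right)
  then have pol: "inner r x \<le> 0" if "x \<in> K" for x using le[OF that] by (simp add: inner_diff_right)
  have ry: "inner r y = norm r * norm r"
    using \<open>inner r p = 0\<close> by (simp add: r_def inner_diff_right power2_norm_eq_inner[symmetric] power2_eq_square[symmetric])
      (simp add: power2_norm_eq_inner inner_diff_right)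
  \<comment> \<open>As \<open>sgn 0 = 0\<close>, the choice \<open>sgn r\<close> also serves for
    \<open>y \<in> K\<close>, where the distance vanishes.\<close>
  show thesis
  proof (rule that[of "sgn r"])
    show "sgn r \<in> polar_cone K"
      using pol by (auto simp: polar_cone_def sgn_div_norm divide_nonpos_nonneg mult_nonneg_nonpos)
    show "norm (sgn r) \<le> 1" by (simp add: norm_sgn)
    show "inner (sgn r) y = infdist y K"
      using ry by (cases "r = 0") (simp_all add: sgn_div_norm dist)
  qed
qed

text \<open>Strong duality for \<open>sup {\<langle>\<mu>, A\<rangle> : \<mu> \<in> M(z*)}\<close> and its exactly penalised dual, where the
  constraint \<open>DG w + A \<in> K\<close> is replaced by \<open>L dist (DG w + A; K)\<close>. The penalisation truncates the
  multipliers to norm \<open>L\<close>, and this compactness is what allows strict separation.\<close>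
lemma penalised_multiplier_duality:
  fixes K :: "'e::euclidean_space set" and DG :: "'z::euclidean_space \<Rightarrow>\<^sub>L 'e"
  assumes K: "closed K" "convex K" "cone K" "0 \<in> K" and "L \<ge> 0"
    and c: "\<And>\<mu>. \<mu> \<in> mult_set DG K zs \<Longrightarrow> inner \<mu> A < c"
  obtains w where "L * infdist (DG w + A) K - inner zs w < c"
proof -
  have lin: "linear (blinfun_apply DG)" by (intro bounded_linear.linear blinfun.bounded_linear_right)
  have adj: "inner w (adjoint (blinfun_apply DG) \<mu>) = inner (DG w) \<mu>" for w \<mu>
    by (rule adjoint_works[OF lin])
  define P where "P = polar_cone K \<inter> cball 0 L"
  define \<phi> where "\<phi> \<mu> = (adjoint (blinfun_apply DG) \<mu> - zs, inner \<mu> A)" for \<mu>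
  have polar: "polar_cone K = (\<Inter>a\<in>K. {x. inner a x \<le> 0})"
    by (auto simp: polar_cone_def inner_commute)
  have "closed (polar_cone K)" "convex (polar_cone K)"
    unfolding polar by (auto intro!: closed_INT convex_INT closed_halfspace_le convex_halfspace_le)
  then have P: "compact P" "convex P"
    unfolding P_def by (auto intro: closed_Int_compact convex_Int)
  have ladj: "linear (adjoint (blinfun_apply DG))" by (rule adjoint_linear[OF lin])
  have "continuous_on P \<phi>" unfolding \<phi>_def
    by (intro continuous_intros linear_continuous_on linear_conv_bounded_linear[THEN iffD1] ladj)
  then have comp: "compact (\<phi> ` P)" using P(1) by (rule compact_continuous_image)
  have "convex ((\<lambda>x. (- zs, 0) + x) ` ((\<lambda>\<mu>. (adjoint (blinfun_apply DG) \<mu>, inner \<mu> A)) ` P))"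
  proof (intro convex_translation convex_linear_image P(2))
    show "linear (\<lambda>\<mu>. (adjoint (blinfun_apply DG) \<mu>, inner \<mu> A))"
      by (intro linearI) (auto simp: linear_add[OF ladj] linear_scale[OF ladj] inner_simps)
  qed
  also have "(\<lambda>x. (- zs, 0) + x) ` ((\<lambda>\<mu>. (adjoint (blinfun_apply DG) \<mu>, inner \<mu> A)) ` P) = \<phi> ` P"
    by (auto simp: \<phi>_def image_image)
  finally have conv: "convex (\<phi> ` P)" .
  have "0 \<in> P" using \<open>L \<ge> 0\<close> by (simp add: P_def polar_cone_def)
  then have ne: "\<phi> ` P \<noteq> {}" by auto
  \<comment> \<open>\<open>\<phi>\<close> pairs the violation of the multiplier equation with the
    objective value. A common point of \<open>T\<close> and the image of \<open>P\<close> would be a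
    multiplier of value at least \<open>c\<close>, so the hypothesis on \<open>c\<close> makes the
    two sets disjoint.\<close>
  define T :: "('z \<times> real) set" where "T = {0} \<times> {c..}"
  have "\<phi> ` P \<inter> T = {}"
  proof (rule ccontr)
    assume "\<phi> ` P \<inter> T \<noteq> {}"
    then obtain \<mu> where "\<mu> \<in> P" "\<phi> \<mu> \<in> T" by auto
    then have "\<mu> \<in> mult_set DG K zs" "c \<le> inner \<mu> A"
      by (auto simp: P_def \<phi>_def T_def mult_set_def)
    then show False using c[of \<mu>] by simp
  qed
  moreover have "convex T" "closed T" by (auto simp: T_def intro: convex_Times closed_Times)
  ultimately obtain s b where
    s1: "\<And>x. x \<in> \<phi> ` P \<Longrightarrow> inner s x < b" and s2: "\<And>x. x \<in> T \<Longrightarrow> inner s x > b"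
    using separating_hyperplane_compact_closed[OF conv comp ne] by meson
  obtain w \<alpha> where s: "s = (w, \<alpha>)" by (cases s)
  have low: "\<alpha> * r > b" if "r \<ge> c" for r
    using s2[of "(0, r)"] that by (simp add: T_def s)
  have up: "inner w (adjoint (blinfun_apply DG) \<mu> - zs) + \<alpha> * inner \<mu> A < b" if "\<mu> \<in> P" for \<mu>
    using s1[of "\<phi> \<mu>"] that by (simp add: \<phi>_def s)
  \<comment> \<open>\<open>T\<close> is unbounded upwards, so a negative slope would break the
    separation far up the ray.\<close>
  have "\<alpha> \<ge> 0"
  proof (rule ccontr)
    assume "\<not> \<alpha> \<ge> 0"
    then have "\<alpha> * max c (b / \<alpha>) \<le> b" by (simp add: max_def field_simps)
    then show False using low[of "max c (b / \<alpha>)"] by simp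
  qed
  have sep: "\<exists>w. \<forall>\<mu>\<in>P. inner w (adjoint (blinfun_apply DG) \<mu> - zs) + inner \<mu> A < c"
  proof (cases "\<alpha> = 0")
    case False
    with \<open>\<alpha> \<ge> 0\<close> have "\<alpha> > 0" by simp
    have "inner (inverse \<alpha> *\<^sub>R w) (adjoint (blinfun_apply DG) \<mu> - zs) + inner \<mu> A < c" if "\<mu> \<in> P" for \<mu>
    proof -
      have "\<alpha> * (inner (inverse \<alpha> *\<^sub>R w) (adjoint (blinfun_apply DG) \<mu> - zs) + inner \<mu> A) < \<alpha> * c"
        using up[OF that] low[of c] \<open>\<alpha> > 0\<close> by (simp add: distrib_left mult.assoc[symmetric])
      then show ?thesis using \<open>\<alpha> > 0\<close> by simp
    qed
    then show ?thesis by blast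
  next
    case True
    then have "b < 0" using low[of c] by simp
    \<comment> \<open>The hyperplane is vertical here, and \<open>w\<close> separates the violations
      alone with margin \<open>- b\<close>. Scaling by \<open>l\<close> lets this margin outweigh
      the objective, which is at most \<open>L * norm A\<close> on the bounded set
      \<open>P\<close>.\<close>
    define l where "l = (L * norm A + \<bar>c\<bar> + 1) / (- b)"
    have "l > 0" using \<open>b < 0\<close> \<open>L \<ge> 0\<close> unfolding l_def by (intro divide_pos_pos) (auto intro: add_nonneg_pos)
    have "inner (l *\<^sub>R w) (adjoint (blinfun_apply DG) \<mu> - zs) + inner \<mu> A < c" if "\<mu> \<in> P" for \<mu>
    proof -
      have "l * inner w (adjoint (blinfun_apply DG) \<mu> - zs) < l * b"
        using up[OF that] True \<open>l > 0\<close> by simp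
      moreover have "l * b = - (L * norm A + \<bar>c\<bar> + 1)" using \<open>b < 0\<close> by (simp add: l_def)
      moreover have "inner \<mu> A \<le> L * norm A"
        using norm_cauchy_schwarz[of \<mu> A] that mult_right_mono[of "norm \<mu>" L "norm A"]
        by (simp add: P_def)
      ultimately show ?thesis by simp
    qed
    then show ?thesis by blast
  qed
  then obtain w where w: "\<And>\<mu>. \<mu> \<in> P \<Longrightarrow> inner w (adjoint (blinfun_apply DG) \<mu> - zs) + inner \<mu> A < c"
    by blast
  obtain \<nu> where \<nu>: "\<nu> \<in> polar_cone K" "norm \<nu> \<le> 1" "inner \<nu> (DG w + A) = infdist (DG w + A) K"
    using infdist_cone_polar[OF K] by blast
  \<comment> \<open>Scaled to norm at most \<open>L\<close>, the polar vector that attains the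
    distance is an element of \<open>P\<close>; its separation inequality is the claim.\<close>
  have "L *\<^sub>R \<nu> \<in> P"
    using \<nu> \<open>L \<ge> 0\<close> by (auto simp: P_def polar_cone_def mult_left_le mult_nonneg_nonpos)
  from w[OF this] have "L * inner \<nu> (DG w + A) - inner zs w < c"
    by (simp add: inner_diff_right adj inner_add_right inner_commute distrib_left)
  then show thesis using that \<nu>(3) by simp
qed

subsection \<open>Sets defined by a cone constraint under MSCQ\<close>

text \<open>The reduced problem with \<open>g\<close>, \<open>h\<close> and \<open>C\<close>
  abstracted away. \<open>expansion\<close> has no constant term because \<open>G zb = 0\<close>;
  \<open>locally_compact\<close> is there to supply minimisers near \<open>zb\<close>.\<close>

locale cone_constraint =
  fixes \<Omega> :: "'z::euclidean_space set" and G :: "'z \<Rightarrow> 'e::euclidean_space" and K :: "'e set"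
    and zb :: 'z and DG :: "'z \<Rightarrow>\<^sub>L 'e" and D2G :: "'z \<Rightarrow>\<^sub>L 'z \<Rightarrow>\<^sub>L 'e"
  assumes K: "closed K" "convex K" "cone K" "0 \<in> K"
    and zb_in: "zb \<in> \<Omega>"
    and locally_compact: "\<exists>r>0. compact (\<Omega> \<inter> cball zb r)"
    and local_eq: "\<exists>r>0. \<forall>z. norm (z - zb) < r \<longrightarrow> (z \<in> \<Omega> \<longleftrightarrow> G z \<in> K)"
    and expansion: "\<And>e. e > 0 \<Longrightarrow> \<exists>\<delta>>0. \<forall>k. norm k < \<delta> \<longrightarrow>
      norm (G (zb + k) - DG k - (1/2) *\<^sub>R D2G k k) \<le> e * (norm k)\<^sup>2"
    and symmetric: "\<And>x y. D2G x y = D2G y x"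
    and mscq: "MSCQ G K zb"
begin

lemma K_scale: "x \<in> K \<Longrightarrow> c \<ge> 0 \<Longrightarrow> c *\<^sub>R x \<in> K"
  using K(3) by (simp add: cone_def)

lemma K_add: "x \<in> K \<Longrightarrow> y \<in> K \<Longrightarrow> x + y \<in> K"
  using convex_cone[of K] K(2,3) by simp

lemma D2G_bound: "norm (D2G x y) \<le> norm D2G * norm x * norm y"
  using norm_blinfun[of "D2G x" y] mult_right_mono[OF norm_blinfun[of D2G x] norm_ge_zero[of y]]
  by (rule order_trans)

text \<open>\<open>MSCQ\<close> measures the distance to the whole preimage of \<open>K\<close>,
  which is known to agree with \<open>\<Omega>\<close> only near \<open>zb\<close>, so the point
  found has to be kept close to \<open>zb\<close>. The slack \<open>\<eta>\<close> stands in for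
  attainment of the distance.\<close>

lemma subregular:
  obtains \<kappa> \<delta> where "\<kappa> \<ge> 0" "\<delta> > 0"
    "\<And>k \<eta>. norm k < \<delta> \<Longrightarrow> \<eta> > 0 \<Longrightarrow> \<exists>z\<in>\<Omega>. norm (z - zb - k) \<le> \<kappa> * infdist (G (zb + k)) K + \<eta>"
proof -
  obtain \<kappa> d where "\<kappa> \<ge> 0" "d > 0"
    and d: "\<And>z. dist z zb < d \<Longrightarrow> infdist z {z. G z \<in> K} \<le> \<kappa> * infdist (G z) K"
    using mscq unfolding MSCQ_def by blast
  obtain r where "r > 0" and r: "\<And>z. norm (z - zb) < r \<Longrightarrow> z \<in> \<Omega> \<longleftrightarrow> G z \<in> K"
    using local_eq by blast
  have zbK: "zb \<in> {z. G z \<in> K}" using r[of zb] \<open>r > 0\<close> zb_in by simp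
  \<comment> \<open>Three contributions of at most \<open>r / 3\<close>: \<open>norm k\<close>, the
    slack, and the distance of \<open>zb + k\<close> to the preimage, which is at most
    \<open>norm k\<close> because \<open>zb\<close> lies in the preimage.\<close>
  show thesis
  proof (rule that[of \<kappa> "min d (r / 3)"])
    show "min d (r / 3) > 0" using \<open>d > 0\<close> \<open>r > 0\<close> by simp
    fix k :: 'z and \<eta> :: real assume k: "norm k < min d (r / 3)" and "\<eta> > 0"
    define i where "i = infdist (zb + k) {z. G z \<in> K}"
    have "{z. G z \<in> K} \<noteq> {}" using zbK by blast
    moreover have "infdist (zb + k) {z. G z \<in> K} < i + min \<eta> (r / 3)"
      using \<open>\<eta> > 0\<close> \<open>r > 0\<close> by (simp add: i_def)
    ultimately obtain z where z: "G z \<in> K" "dist (zb + k) z < i + min \<eta> (r / 3)"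
      by (metis infdist_lessE mem_Collect_eq)
    have "i \<le> norm k" unfolding i_def using infdist_le[OF zbK, of "zb + k"] by (simp add: dist_norm)
    have zk: "norm (z - zb - k) = dist (zb + k) z"
      by (simp add: dist_norm norm_minus_commute algebra_simps)
    have "norm (z - zb) \<le> norm (z - zb - k) + norm k"
      using norm_triangle_ineq[of "z - zb - k" k] by simp
    then have "norm (z - zb) < r" using z(2) zk k \<open>i \<le> norm k\<close> by auto
    then have "z \<in> \<Omega>" using r z(1) by blast
    moreover have "norm (z - zb - k) \<le> \<kappa> * infdist (G (zb + k)) K + \<eta>"
      using z(2) zk d[of "zb + k"] k by (auto simp: i_def dist_norm)
    ultimately show "\<exists>z\<in>\<Omega>. norm (z - zb - k) \<le> \<kappa> * infdist (G (zb + k)) K + \<eta>" by blast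
  qed (fact \<open>\<kappa> \<ge> 0\<close>)
qed

section \<open>First-order geometry: tangent and critical cones\<close>

lemma first_order_expansion:
  obtains c \<delta> where "c \<ge> 0" "\<delta> > 0" "\<And>k. norm k < \<delta> \<Longrightarrow> norm (G (zb + k) - DG k) \<le> c * (norm k)\<^sup>2"
proof -
  obtain \<delta> where "\<delta> > 0" and \<delta>: "\<And>k. norm k < \<delta> \<Longrightarrow>
      norm (G (zb + k) - DG k - (1/2) *\<^sub>R D2G k k) \<le> 1 * (norm k)\<^sup>2"
    using expansion[of 1] by auto
  show thesis
  proof (rule that[of "1 + norm D2G" \<delta>])
    fix k :: 'z assume "norm k < \<delta>"
    have "norm (G (zb + k) - DG k) \<le> norm (G (zb + k) - DG k - (1/2) *\<^sub>R D2G k k) + norm ((1/2) *\<^sub>R D2G k k)"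
      using norm_triangle_ineq[of "G (zb + k) - DG k - (1/2) *\<^sub>R D2G k k" "(1/2) *\<^sub>R D2G k k"] by simp
    also have "\<dots> \<le> (norm k)\<^sup>2 + norm D2G * (norm k)\<^sup>2"
    proof (rule add_mono)
      have "norm ((1/2) *\<^sub>R D2G k k) \<le> norm (D2G k k)" by simp
      also have "\<dots> \<le> norm D2G * (norm k)\<^sup>2"
        using D2G_bound[of k k] by (simp add: power2_eq_square mult.assoc)
      finally show "norm ((1/2) *\<^sub>R D2G k k) \<le> norm D2G * (norm k)\<^sup>2" .
    qed (use \<delta>[OF \<open>norm k < \<delta>\<close>] in simp)
    finally show "norm (G (zb + k) - DG k) \<le> (1 + norm D2G) * (norm k)\<^sup>2"
      by (simp add: distrib_right)
  qed (use \<open>\<delta> > 0\<close> in auto)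
qed

text \<open>Dividing \<open>G (zb + t k *\<^sub>R wk k)\<close> by \<open>t k\<close> stays in the
  cone, and by the first-order expansion the quotients converge to \<open>DG w\<close>; closedness
  of \<open>K\<close> concludes.\<close>

lemma tangent_limit:
  assumes t: "\<And>k. t k > 0" "t \<longlonglongrightarrow> 0" and w: "wk \<longlonglongrightarrow> w"
    and in\<Omega>: "\<And>k. zb + t k *\<^sub>R wk k \<in> \<Omega>"
  shows "DG w \<in> K"
proof -
  obtain c \<delta> where "c \<ge> 0" "\<delta> > 0" and c: "\<And>k. norm k < \<delta> \<Longrightarrow> norm (G (zb + k) - DG k) \<le> c * (norm k)\<^sup>2"
    using first_order_expansion by blast
  obtain r where "r > 0" and r: "\<And>z. norm (z - zb) < r \<Longrightarrow> z \<in> \<Omega> \<longleftrightarrow> G z \<in> K"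
    using local_eq by blast
  have tw: "(\<lambda>k. norm (t k *\<^sub>R wk k)) \<longlonglongrightarrow> 0"
    using tendsto_norm[OF tendsto_scaleR[OF t(2) w]] by simp
  have ev: "\<forall>\<^sub>F k in sequentially. norm (t k *\<^sub>R wk k) < min \<delta> r"
    by (rule order_tendstoD(2)[OF tw]) (use \<open>\<delta> > 0\<close> \<open>r > 0\<close> in simp)
  define y where "y k = inverse (t k) *\<^sub>R G (zb + t k *\<^sub>R wk k)" for k
  have yK: "\<forall>\<^sub>F k in sequentially. y k \<in> K"
    using ev
  proof eventually_elim
    case (elim k)
    then have "G (zb + t k *\<^sub>R wk k) \<in> K"
      using r[of "zb + t k *\<^sub>R wk k"] in\<Omega>[of k] by simp
    then show ?case using t(1)[of k] by (simp add: y_def K_scale)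
  qed
  have "(\<lambda>k. y k - DG (wk k)) \<longlonglongrightarrow> 0"
  proof (rule Lim_null_comparison)
    show "\<forall>\<^sub>F k in sequentially. norm (y k - DG (wk k)) \<le> c * (t k * (norm (wk k))\<^sup>2)"
      using ev
    proof eventually_elim
      case (elim k)
      have "y k - DG (wk k) = inverse (t k) *\<^sub>R (G (zb + t k *\<^sub>R wk k) - DG (t k *\<^sub>R wk k))"
        using t(1)[of k] by (simp add: y_def blinfun.bilinear_simps scaleR_diff_right)
      then have "norm (y k - DG (wk k)) = norm (G (zb + t k *\<^sub>R wk k) - DG (t k *\<^sub>R wk k)) / t k"
        using t(1)[of k] by (simp add: divide_inverse mult.commute)
      also have "\<dots> \<le> c * (norm (t k *\<^sub>R wk k))\<^sup>2 / t k"
        using c[of "t k *\<^sub>R wk k"] elim t(1)[of k] by (intro divide_right_mono) simp_all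
      also have "\<dots> = c * (t k * (norm (wk k))\<^sup>2)"
        using t(1)[of k] by (simp add: power2_eq_square)
      finally show ?case .
    qed
    have "(\<lambda>k. c * (t k * (norm (wk k))\<^sup>2)) \<longlonglongrightarrow> c * (0 * (norm w)\<^sup>2)"
      by (intro tendsto_intros t w)
    then show "(\<lambda>k. c * (t k * (norm (wk k))\<^sup>2)) \<longlonglongrightarrow> 0" by simp
  qed
  moreover have "(\<lambda>k. DG (wk k)) \<longlonglongrightarrow> DG w"
    by (intro tendsto_intros w)
  ultimately have "y \<longlonglongrightarrow> DG w"
    using tendsto_add[of "\<lambda>k. y k - DG (wk k)" 0 sequentially "\<lambda>k. DG (wk k)"] by simp
  then show ?thesis
    using Lim_in_closed_set[OF K(1) yK] by simp
qed

text \<open>MSCQ makes the linearised cone exact: if \<open>DG w \<in> K\<close>, then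
  \<open>zb + t *\<^sub>R w\<close> has a constraint residual of order \<open>t\<^sup>2\<close>,
  hence a point of \<open>\<Omega>\<close> within a distance of order
  \<open>t\<^sup>2\<close>.\<close>

lemma tangent_cone_eq: "tangent_cone \<Omega> zb = {w. DG w \<in> K}"
proof (intro equalityI subsetI)
  fix w assume "w \<in> tangent_cone \<Omega> zb"
  then show "w \<in> {w. DG w \<in> K}"
    unfolding tangent_cone_def using tangent_limit by blast
next
  fix w assume "w \<in> {w. DG w \<in> K}"
  then have w: "DG w \<in> K" by simp
  obtain c d where "c \<ge> 0" "d > 0" and c: "\<And>k. norm k < d \<Longrightarrow> norm (G (zb + k) - DG k) \<le> c * (norm k)\<^sup>2"
    using first_order_expansion by blast
  obtain \<kappa> d' where "\<kappa> \<ge> 0" "d' > 0" and sub: "\<And>k \<eta>. norm k < d' \<Longrightarrow> \<eta> > 0 \<Longrightarrow>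
      \<exists>z\<in>\<Omega>. norm (z - zb - k) \<le> \<kappa> * infdist (G (zb + k)) K + \<eta>"
    using subregular by blast
  have "derivable_tangent \<Omega> zb w"
  proof (rule derivable_tangentI[OF zb_in])
    fix e :: real assume "e > 0"
    define M where "M = \<kappa> * (c * (norm w)\<^sup>2) + 1"
    have "M > 0" using \<open>\<kappa> \<ge> 0\<close> \<open>c \<ge> 0\<close> by (simp add: M_def add_nonneg_pos)
    define \<delta> where "\<delta> = min (min d d' / (norm w + 1)) (e / M)"
    have w1: "norm w + 1 > 0" by (simp add: add_nonneg_pos)
    have "\<delta> > 0" using \<open>d > 0\<close> \<open>d' > 0\<close> \<open>e > 0\<close> \<open>M > 0\<close> w1 by (simp add: \<delta>_def)
    moreover have "\<exists>y\<in>\<Omega>. norm (y - zb - t *\<^sub>R w) \<le> e * t" if t: "0 < t" "t < \<delta>" for t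
    proof -
      have "t * (norm w + 1) < min d d'" using t w1 by (simp add: \<delta>_def pos_less_divide_eq)
      moreover have "norm (t *\<^sub>R w) < t * (norm w + 1)" using t by simp
      ultimately have small: "norm (t *\<^sub>R w) < d" "norm (t *\<^sub>R w) < d'" by auto
      have "infdist (G (zb + t *\<^sub>R w)) K \<le> norm (G (zb + t *\<^sub>R w) - DG (t *\<^sub>R w))"
        using infdist_le[OF K_scale[OF w, of t], of "G (zb + t *\<^sub>R w)"] t
        by (simp add: dist_norm blinfun.bilinear_simps)
      also have "\<dots> \<le> c * (norm w)\<^sup>2 * t\<^sup>2"
        using c[OF small(1)] by (simp add: power_mult_distrib mult_ac)
      finally have "\<kappa> * infdist (G (zb + t *\<^sub>R w)) K \<le> \<kappa> * (c * (norm w)\<^sup>2 * t\<^sup>2)"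
        using \<open>\<kappa> \<ge> 0\<close> by (rule mult_left_mono)
      moreover obtain y where "y \<in> \<Omega>" "norm (y - zb - t *\<^sub>R w) \<le> \<kappa> * infdist (G (zb + t *\<^sub>R w)) K + t\<^sup>2"
        using sub[OF small(2), of "t\<^sup>2"] t by auto
      ultimately have "norm (y - zb - t *\<^sub>R w) \<le> M * t * t"
        by (simp add: M_def power2_eq_square algebra_simps)
      also have "\<dots> \<le> e * t"
        using t \<open>M > 0\<close> by (simp add: \<delta>_def pos_less_divide_eq mult.commute)
      finally show ?thesis using \<open>y \<in> \<Omega>\<close> by blast
    qed
    ultimately show "\<exists>\<delta>>0. \<forall>t. 0 < t \<and> t < \<delta> \<longrightarrow> (\<exists>y\<in>\<Omega>. norm (y - zb - t *\<^sub>R w) \<le> e * t)" by blast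
  qed
  then show "w \<in> tangent_cone \<Omega> zb" by (simp add: derivable_tangent_def)
qed

lemma critical_cone_eq: "critical_cone \<Omega> zb zs = {w. DG w \<in> K \<and> inner zs w = 0}"
  by (simp add: critical_cone_def tangent_cone_eq)

text \<open>The critical cone is convex, so from \<open>v\<close> all its elements are feasible
  directions, and so is \<open>- v\<close> for steps shorter than \<open>1\<close>. Along such
  directions \<open>key\<close> divides the normal inequality by the step length.\<close>

lemma normal_to_critical_cone:
  assumes ws: "ws \<in> regular_normal_cone (critical_cone \<Omega> zb zs) v"
  shows "ws \<in> polar_cone (critical_cone \<Omega> zb zs)" "inner ws v = 0"
proof -
  define A where "A = critical_cone \<Omega> zb zs"
  have vA: "v \<in> A" using ws by (simp add: regular_normal_cone_def A_def)
  have key: "inner ws k \<le> 0" if "s > 0" and k: "\<And>t. 0 < t \<Longrightarrow> t < s \<Longrightarrow> v + t *\<^sub>R k \<in> A" for k s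
  proof (cases "k = 0")
    case False
    have bound: "inner ws k \<le> e * norm k" if "e > 0" for e
    proof -
      obtain \<delta> where "\<delta> > 0" and \<delta>: "\<And>z. z \<in> A \<Longrightarrow> 0 < norm (z - v) \<Longrightarrow> norm (z - v) < \<delta> \<Longrightarrow>
          inner ws (z - v) \<le> e * norm (z - v)"
        using ws \<open>e > 0\<close> unfolding regular_normal_cone_def A_def by blast
      define m where "m = min s (\<delta> / norm k)"
      have m: "m > 0" "m \<le> s" "m \<le> \<delta> / norm k"
        using \<open>\<delta> > 0\<close> \<open>s > 0\<close> False by (simp_all add: m_def)
      define t where "t = m / 2"
      have "t < m" using m(1) by (simp add: t_def)
      then have t: "0 < t" "t < s" "t < \<delta> / norm k"
        using m(1) less_le_trans[OF \<open>t < m\<close> m(2)] less_le_trans[OF \<open>t < m\<close> m(3)]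
        by (simp_all add: t_def)
      have "norm (v + t *\<^sub>R k - v) < \<delta>"
        using t False by (simp add: pos_less_divide_eq)
      moreover have "0 < norm (v + t *\<^sub>R k - v)" using t False by simp
      ultimately have "inner ws (v + t *\<^sub>R k - v) \<le> e * norm (v + t *\<^sub>R k - v)"
        using \<delta>[OF k[OF t(1,2)]] by blast
      then have "t * inner ws k \<le> t * (e * norm k)" using t by (simp add: mult_ac)
      then show ?thesis using t by simp
    qed
    show ?thesis
    proof (rule field_le_epsilon)
      fix e :: real assume "e > 0"
      then show "inner ws k \<le> 0 + e" using bound[of "e / norm k"] False by simp
    qed
  qed simp
  have cone: "a *\<^sub>R x + b *\<^sub>R y \<in> A" if "x \<in> A" "y \<in> A" "a \<ge> 0" "b \<ge> 0" for a b x y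
    using that by (auto simp: A_def critical_cone_eq blinfun.bilinear_simps inner_add_right intro!: K_add K_scale)
  show "ws \<in> polar_cone (critical_cone \<Omega> zb zs)"
    unfolding polar_cone_def A_def[symmetric]
  proof (intro CollectI ballI)
    fix k assume "k \<in> A"
    then have "v + t *\<^sub>R k \<in> A" if "0 < t" for t
      using cone[OF vA, of k 1 t] that by simp
    then show "inner ws k \<le> 0" using key[OF zero_less_one] by blast
  qed
  have "inner ws (- v) \<le> 0"
  proof (rule key[OF zero_less_one])
    fix t :: real assume "0 < t" "t < 1"
    then show "v + t *\<^sub>R (- v) \<in> A"
      using cone[OF vA vA, of "1 - t" 0] by (simp add: algebra_simps)
  qed
  moreover have "inner ws v \<le> 0"
  proof (rule key[OF zero_less_one])
    fix t :: real assume "0 < t" "t < 1"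
    then show "v + t *\<^sub>R v \<in> A" using cone[OF vA vA, of 1 t] by simp
  qed
  ultimately show "inner ws v = 0" by simp
qed

section \<open>Second-order estimates on and near the constraint set\<close>

lemma parabolic_expansion:
  assumes "e > 0"
  obtains \<delta> where "\<delta> > 0" "\<And>t. 0 < t \<Longrightarrow> t < \<delta> \<Longrightarrow>
    norm (G (zb + (t *\<^sub>R v + (t\<^sup>2 / 2) *\<^sub>R w)) - (t *\<^sub>R DG v + (t\<^sup>2 / 2) *\<^sub>R (DG w + D2G v v))) \<le> e * t\<^sup>2"
proof -
  \<comment> \<open>For \<open>t \<le> 1\<close> the parabola satisfies
    \<open>norm k \<le> t * b\<close>, so the tolerance \<open>e / (2 * b\<^sup>2)\<close> in the
    expansion uses half of the allowed error. The other half absorbs the terms of order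
    \<open>t ^ 3\<close> and \<open>t ^ 4\<close> collected in \<open>R\<close>.\<close>
  define b where "b = norm v + norm w + 1"
  have "b > 0" by (simp add: b_def add_nonneg_pos)
  define c where "c = norm (D2G v w) + norm (D2G w w)"
  obtain d where "d > 0" and d: "\<And>k. norm k < d \<Longrightarrow>
      norm (G (zb + k) - DG k - (1/2) *\<^sub>R D2G k k) \<le> (e / (2 * b\<^sup>2)) * (norm k)\<^sup>2"
    using expansion[of "e / (2 * b\<^sup>2)"] \<open>e > 0\<close> \<open>b > 0\<close> by auto
  define \<delta> where "\<delta> = min 1 (min (d / b) (e / (2 * (c + 1))))"
  have "c \<ge> 0" by (simp add: c_def)
  show thesis
  proof (rule that[of \<delta>])
    show "\<delta> > 0" using \<open>d > 0\<close> \<open>b > 0\<close> \<open>c \<ge> 0\<close> \<open>e > 0\<close> by (simp add: \<delta>_def)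
    fix t assume t: "0 < t" "t < \<delta>"
    define k where "k = t *\<^sub>R v + (t\<^sup>2 / 2) *\<^sub>R w"
    have t2: "t\<^sup>2 \<le> t" using t by (simp add: \<delta>_def power2_eq_square)
    have "norm k \<le> t * norm v + t\<^sup>2 / 2 * norm w"
      using norm_triangle_ineq[of "t *\<^sub>R v" "(t\<^sup>2 / 2) *\<^sub>R w"] t by (simp add: k_def)
    also have "\<dots> \<le> t * norm v + t * norm w"
      using t2 t by (intro add_left_mono mult_right_mono) auto
    finally have kb: "norm k \<le> t * b" using t by (simp add: b_def distrib_left)
    also have "\<dots> < d" using t \<open>b > 0\<close> by (simp add: \<delta>_def pos_less_divide_eq)
    finally have "norm (G (zb + k) - DG k - (1/2) *\<^sub>R D2G k k) \<le> (e / (2 * b\<^sup>2)) * (norm k)\<^sup>2"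
      by (rule d)
    also have "\<dots> \<le> (e / (2 * b\<^sup>2)) * (t * b)\<^sup>2"
      using kb \<open>e > 0\<close> by (intro mult_left_mono power_mono) auto
    also have "\<dots> = e / 2 * t\<^sup>2" using \<open>b > 0\<close> by (simp add: power_mult_distrib)
    finally have 1: "norm (G (zb + k) - DG k - (1/2) *\<^sub>R D2G k k) \<le> e / 2 * t\<^sup>2" .
    define R where "R = (t ^ 3 / 2) *\<^sub>R D2G v w + (t ^ 4 / 8) *\<^sub>R D2G w w"
    have quad: "D2G k k = (t * t) *\<^sub>R D2G v v + (t * (t\<^sup>2 / 2)) *\<^sub>R D2G v w
        + ((t\<^sup>2 / 2) * t) *\<^sub>R D2G v w + ((t\<^sup>2 / 2) * (t\<^sup>2 / 2)) *\<^sub>R D2G w w"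
      by (simp add: k_def blinfun.bilinear_simps symmetric[of w v] scaleR_add_right)
    have "(1/2 * (t * (t\<^sup>2 / 2))) *\<^sub>R x + (1/2 * (t\<^sup>2 / 2 * t)) *\<^sub>R x = (t ^ 3 / 2) *\<^sub>R x" for x :: 'e
      unfolding scaleR_left_distrib[symmetric] by (simp add: power2_eq_square power3_eq_cube)
    then have "(1/2) *\<^sub>R D2G k k = (t\<^sup>2 / 2) *\<^sub>R D2G v v + R"
      unfolding R_def quad scaleR_add_right scaleR_scaleR
      by (simp add: power2_eq_square power4_eq_xxxx add.assoc)
    then have split: "G (zb + k) - (t *\<^sub>R DG v + (t\<^sup>2 / 2) *\<^sub>R (DG w + D2G v v))
        = (G (zb + k) - DG k - (1/2) *\<^sub>R D2G k k) + R"
      by (simp add: k_def blinfun.bilinear_simps scaleR_add_right)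
    have "norm R \<le> t ^ 3 / 2 * norm (D2G v w) + t ^ 4 / 8 * norm (D2G w w)"
      unfolding R_def using norm_triangle_ineq[of "(t ^ 3 / 2) *\<^sub>R D2G v w" "(t ^ 4 / 8) *\<^sub>R D2G w w"] t by simp
    also have "\<dots> \<le> t ^ 3 * norm (D2G v w) + t ^ 3 * norm (D2G w w)"
    proof (intro add_mono mult_right_mono)
      have "t ^ 4 \<le> t ^ 3" using t by (intro power_decreasing) (auto simp: \<delta>_def)
      then show "t ^ 4 / 8 \<le> t ^ 3" using t zero_less_power[of t 3] by linarith
    qed (use t in auto)
    also have "\<dots> = t * c * t\<^sup>2" by (simp add: c_def power2_eq_square power3_eq_cube algebra_simps)
    also have "\<dots> \<le> e / 2 * t\<^sup>2"
    proof (rule mult_right_mono)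
      have "t * (2 * (c + 1)) < e" using t \<open>c \<ge> 0\<close> by (simp add: \<delta>_def pos_less_divide_eq)
      then show "t * c \<le> e / 2" using t by (simp add: distrib_left)
    qed simp
    finally have "norm R \<le> e / 2 * t\<^sup>2" .
    then show "norm (G (zb + (t *\<^sub>R v + (t\<^sup>2 / 2) *\<^sub>R w)) -
        (t *\<^sub>R DG v + (t\<^sup>2 / 2) *\<^sub>R (DG w + D2G v v))) \<le> e * t\<^sup>2"
      using 1 norm_triangle_ineq[of "G (zb + k) - DG k - (1/2) *\<^sub>R D2G k k" R]
      unfolding k_def[symmetric] split by simp
  qed
qed

text \<open>A parabola with acceleration \<open>w\<close> is corrected to a point of
  \<open>\<Omega>\<close> by \<open>subregular\<close>. The correction costs \<open>\<kappa>\<close>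
  times the residual and so changes the pairing with \<open>zs\<close> by at most
  \<open>norm zs * \<kappa>\<close> times it; this product is the penalty weight with which duality
  provides \<open>w\<close>.\<close>

lemma recovery_curve:
  assumes v: "DG v \<in> K" "inner zs v = 0"
    and m: "\<And>\<nu>. \<nu> \<in> mult_set DG K zs \<Longrightarrow> inner \<nu> (D2G v v) \<le> m"
    and "e > 0"
  obtains M \<delta> where "M \<ge> 0" "\<delta> > 0" "\<And>t. 0 < t \<Longrightarrow> t < \<delta> \<Longrightarrow>
    \<exists>z\<in>\<Omega>. norm (z - zb - t *\<^sub>R v) \<le> M * t\<^sup>2 \<and> - inner zs (z - zb) \<le> t\<^sup>2 / 2 * (m + e)"
proof -
  obtain \<kappa> d where "\<kappa> \<ge> 0" "d > 0" and sub: "\<And>k \<eta>. norm k < d \<Longrightarrow> \<eta> > 0 \<Longrightarrow>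
      \<exists>z\<in>\<Omega>. norm (z - zb - k) \<le> \<kappa> * infdist (G (zb + k)) K + \<eta>"
    using subregular by blast
  have m': "\<nu> \<in> mult_set DG K zs \<Longrightarrow> inner \<nu> (D2G v v) < m + e / 2" for \<nu>
    using m[of \<nu>] \<open>e > 0\<close> by simp
  obtain w where w: "norm zs * \<kappa> * infdist (DG w + D2G v v) K - inner zs w < m + e / 2"
    using penalised_multiplier_duality[OF K mult_nonneg_nonneg[OF norm_ge_zero \<open>\<kappa> \<ge> 0\<close>] m'] by blast
  define i where "i = infdist (DG w + D2G v v) K"
  have "i \<ge> 0" by (simp add: i_def infdist_nonneg)
  \<comment> \<open>Half of \<open>e\<close> goes to the duality gap. The rest,
    \<open>2 * \<eta> * n = e / 2\<close>, covers the expansion error magnified by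
    \<open>\<kappa>\<close> and the slack in \<open>subregular\<close>.\<close>
  define n where "n = norm zs * (\<kappa> + 1) + 1"
  have "n > 0" using \<open>\<kappa> \<ge> 0\<close> by (simp add: n_def add_nonneg_pos)
  define \<eta> where "\<eta> = e / (4 * n)"
  have "\<eta> > 0" using \<open>e > 0\<close> \<open>n > 0\<close> by (simp add: \<eta>_def)
  obtain d' where "d' > 0" and d': "\<And>t. 0 < t \<Longrightarrow> t < d' \<Longrightarrow>
    norm (G (zb + (t *\<^sub>R v + (t\<^sup>2 / 2) *\<^sub>R w)) - (t *\<^sub>R DG v + (t\<^sup>2 / 2) *\<^sub>R (DG w + D2G v v))) \<le> \<eta> * t\<^sup>2"
    using parabolic_expansion[OF \<open>\<eta> > 0\<close>] by blast
  define b where "b = norm v + norm w + 1"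
  have "b > 0" by (simp add: b_def add_nonneg_pos)
  define M where "M = norm w / 2 + (\<kappa> * (\<eta> + i / 2) + \<eta>)"
  show thesis
  proof (rule that[of M "min 1 (min d' (d / b))"])
    show "M \<ge> 0" using \<open>\<kappa> \<ge> 0\<close> \<open>\<eta> > 0\<close> \<open>i \<ge> 0\<close> by (simp add: M_def)
    show "min 1 (min d' (d / b)) > 0" using \<open>d > 0\<close> \<open>d' > 0\<close> \<open>b > 0\<close> by simp
    fix t :: real assume t: "0 < t" "t < min 1 (min d' (d / b))"
    define k where "k = t *\<^sub>R v + (t\<^sup>2 / 2) *\<^sub>R w"
    have "norm k \<le> t * norm v + t\<^sup>2 / 2 * norm w"
      using norm_triangle_ineq[of "t *\<^sub>R v" "(t\<^sup>2 / 2) *\<^sub>R w"] t by (simp add: k_def)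
    also have "\<dots> \<le> t * norm v + t * norm w"
      using t by (intro add_left_mono mult_right_mono) (auto simp: power2_eq_square)
    also have "\<dots> \<le> t * b" using t by (simp add: b_def distrib_left)
    also have "\<dots> < d" using t \<open>b > 0\<close> by (simp add: pos_less_divide_eq)
    finally have "norm k < d" .
    then obtain z where z: "z \<in> \<Omega>" "norm (z - zb - k) \<le> \<kappa> * infdist (G (zb + k)) K + \<eta> * t\<^sup>2"
      using sub[of k "\<eta> * t\<^sup>2"] t \<open>\<eta> > 0\<close> by auto
    have ne: "K \<noteq> {}" using K(4) by auto
    \<comment> \<open>Adding a multiple of \<open>DG v\<close> to a multiple of the nearest point
      \<open>p\<close> stays in the convex cone, so the first-order term does not enlarge the
      residual.\<close>
    obtain p where p: "p \<in> K" "i = dist (DG w + D2G v v) p"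
      using infdist_attains_inf[OF K(1) ne] unfolding i_def by blast
    have "t *\<^sub>R DG v + (t\<^sup>2 / 2) *\<^sub>R p \<in> K"
      using v p t by (intro K_add K_scale) auto
    then have "infdist (t *\<^sub>R DG v + (t\<^sup>2 / 2) *\<^sub>R (DG w + D2G v v)) K
        \<le> dist (t *\<^sub>R DG v + (t\<^sup>2 / 2) *\<^sub>R (DG w + D2G v v)) (t *\<^sub>R DG v + (t\<^sup>2 / 2) *\<^sub>R p)"
      by (rule infdist_le)
    also have "\<dots> = norm ((t\<^sup>2 / 2) *\<^sub>R (DG w + D2G v v - p))"
      by (simp add: dist_norm scaleR_diff_right)
    also have "\<dots> = t\<^sup>2 / 2 * i" by (simp add: p(2) dist_norm)
    finally have "infdist (G (zb + k)) K \<le> t\<^sup>2 / 2 * i + \<eta> * t\<^sup>2"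
      using infdist_triangle[of "G (zb + k)" K "t *\<^sub>R DG v + (t\<^sup>2 / 2) *\<^sub>R (DG w + D2G v v)"]
        d'[of t] t unfolding k_def dist_norm by simp
    then have "\<kappa> * infdist (G (zb + k)) K \<le> \<kappa> * (t\<^sup>2 / 2 * i + \<eta> * t\<^sup>2)"
      using \<open>\<kappa> \<ge> 0\<close> by (rule mult_left_mono)
    with z(2) have zk: "norm (z - zb - k) \<le> t\<^sup>2 * (\<kappa> * (\<eta> + i / 2) + \<eta>)"
      by (simp add: algebra_simps)
    have "norm (z - zb - t *\<^sub>R v) \<le> norm (z - zb - k) + norm ((t\<^sup>2 / 2) *\<^sub>R w)"
      using norm_triangle_ineq[of "z - zb - k" "(t\<^sup>2 / 2) *\<^sub>R w"] by (simp add: k_def)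
    also have "\<dots> \<le> M * t\<^sup>2" using zk by (simp add: M_def algebra_simps)
    finally have 1: "norm (z - zb - t *\<^sub>R v) \<le> M * t\<^sup>2" .
    have "- inner zs (z - zb) = - inner zs (z - zb - k) - t\<^sup>2 / 2 * inner zs w"
      using v(2) by (simp add: k_def inner_simps)
    also have "- inner zs (z - zb - k) \<le> norm zs * norm (z - zb - k)"
      using norm_cauchy_schwarz[of "- zs" "z - zb - k"] by simp
    also have "\<dots> \<le> norm zs * (t\<^sup>2 * (\<kappa> * (\<eta> + i / 2) + \<eta>))"
      using zk by (intro mult_left_mono) auto
    also have "\<dots> - t\<^sup>2 / 2 * inner zs w
        = t\<^sup>2 / 2 * ((norm zs * \<kappa> * i - inner zs w) + 2 * \<eta> * (norm zs * (\<kappa> + 1)))"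
      by (simp add: algebra_simps)
    also have "\<dots> \<le> t\<^sup>2 / 2 * ((m + e / 2) + e / 2)"
    proof (intro mult_left_mono add_mono)
      show "norm zs * \<kappa> * i - inner zs w \<le> m + e / 2" using w by (simp add: i_def)
      have "2 * \<eta> * (norm zs * (\<kappa> + 1)) \<le> 2 * \<eta> * n"
        using \<open>\<eta> > 0\<close> by (simp add: n_def)
      also have "\<dots> = e / 2" using \<open>n > 0\<close> by (simp add: \<eta>_def)
      finally show "2 * \<eta> * (norm zs * (\<kappa> + 1)) \<le> e / 2" .
    qed simp
    also have "(m + e / 2) + e / 2 = m + e" by simp
    finally have "- inner zs (z - zb) \<le> t\<^sup>2 / 2 * (m + e)" by simp
    with 1 z(1) show "\<exists>z\<in>\<Omega>. norm (z - zb - t *\<^sub>R v) \<le> M * t\<^sup>2 \<and> - inner zs (z - zb) \<le> t\<^sup>2 / 2 * (m + e)"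
      by blast
  qed
qed

text \<open>Pair the expansion with \<open>\<mu>\<close>: on \<open>\<Omega>\<close> the value
  \<open>inner \<mu> (G z)\<close> is nonpositive by polarity, and the linear term is
  \<open>inner zs (z - zb)\<close> by the multiplier equation.\<close>

lemma curvature_lower_bound:
  assumes \<mu>: "\<mu> \<in> mult_set DG K zs" and "e > 0"
  obtains \<delta> where "\<delta> > 0" "\<And>z. z \<in> \<Omega> \<Longrightarrow> norm (z - zb) < \<delta> \<Longrightarrow>
    inner \<mu> (D2G (z - zb) (z - zb)) / 2 - e * (norm (z - zb))\<^sup>2 \<le> - inner zs (z - zb)"
proof -
  obtain r where "r > 0" and r: "\<And>z. norm (z - zb) < r \<Longrightarrow> z \<in> \<Omega> \<longleftrightarrow> G z \<in> K"
    using local_eq by blast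
  have n: "norm \<mu> + 1 > 0" by (simp add: add_nonneg_pos)
  obtain d where "d > 0" and d: "\<And>k. norm k < d \<Longrightarrow>
      norm (G (zb + k) - DG k - (1/2) *\<^sub>R D2G k k) \<le> e / (norm \<mu> + 1) * (norm k)\<^sup>2"
    using expansion[of "e / (norm \<mu> + 1)"] \<open>e > 0\<close> n by auto
  show thesis
  proof (rule that[of "min r d"])
    fix z assume z: "z \<in> \<Omega>" "norm (z - zb) < min r d"
    define k where "k = z - zb"
    define R where "R = G (zb + k) - DG k - (1/2) *\<^sub>R D2G k k"
    have "G (zb + k) \<in> K" using r z by (simp add: k_def)
    then have "inner \<mu> (G (zb + k)) \<le> 0" using \<mu> by (auto simp: mult_set_def polar_cone_def)
    moreover have "inner \<mu> (DG k) = inner zs k"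
      using \<mu> adjoint_clauses(2)[of "blinfun_apply DG" \<mu> k]
      by (auto simp: mult_set_def bounded_linear.linear blinfun.bounded_linear_right)
    moreover have "inner \<mu> R = inner \<mu> (G (zb + k)) - inner \<mu> (DG k) - inner \<mu> (D2G k k) / 2"
      by (simp add: R_def inner_diff_right)
    moreover have "- inner \<mu> R \<le> e * (norm k)\<^sup>2"
    proof -
      have "- inner \<mu> R \<le> norm \<mu> * norm R" using norm_cauchy_schwarz[of "- \<mu>" R] by simp
      also have "\<dots> \<le> (norm \<mu> + 1) * (e / (norm \<mu> + 1) * (norm k)\<^sup>2)"
        using d[of k] z by (intro mult_mono) (auto simp: R_def k_def)
      also have "\<dots> = e * (norm k)\<^sup>2" using n by simp
      finally show ?thesis .
    qed
    ultimately show "inner \<mu> (D2G (z - zb) (z - zb)) / 2 - e * (norm (z - zb))\<^sup>2 \<le> - inner zs (z - zb)"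
      unfolding k_def[symmetric] by linarith
  qed (use \<open>r > 0\<close> \<open>d > 0\<close> in simp)
qed

text \<open>The estimate \<open>- \<langle>z*, d\<rangle> \<le> C t\<close> is what forces limits of \<open>d\<close> as \<open>t\<close> tends to 0 into the
  critical cone.\<close>
lemma polar_critical_bound:
  assumes n: "n \<in> polar_cone (critical_cone \<Omega> zb zs)"
    and \<mu>: "\<mu> \<in> mult_set DG K zs" and "e > 0"
  obtains \<delta> where "\<delta> > 0" "\<And>t d. 0 < t \<Longrightarrow> t < \<delta> \<Longrightarrow> zb + t *\<^sub>R d \<in> \<Omega> \<Longrightarrow> norm d \<le> R \<Longrightarrow>
    - inner zs d \<le> C * t \<Longrightarrow> inner n d \<le> e"
proof -
  have "\<exists>\<delta>>0. \<forall>t d. 0 < t \<and> t < \<delta> \<and> zb + t *\<^sub>R d \<in> \<Omega> \<and> norm d \<le> R \<and> - inner zs d \<le> C * t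
    \<longrightarrow> inner n d \<le> e"
  proof (rule ccontr)
    assume neg: "\<not> ?thesis"
    have "\<exists>t d. 0 < t \<and> t < inverse (real (Suc j)) \<and> zb + t *\<^sub>R d \<in> \<Omega> \<and> norm d \<le> R \<and>
        - inner zs d \<le> C * t \<and> inner n d > e" for j
      using neg by (metis inverse_positive_iff_positive of_nat_0_less_iff zero_less_Suc not_le)
    then obtain t d where td: "\<And>j. 0 < t j" "\<And>j. t j < inverse (real (Suc j))"
      "\<And>j. zb + t j *\<^sub>R d j \<in> \<Omega>" "\<And>j. norm (d j) \<le> R" "\<And>j. - inner zs (d j) \<le> C * t j"
      "\<And>j. inner n (d j) > e"
      by metis
    have t0: "t \<longlonglongrightarrow> 0"
      by (rule tendsto_sandwich[OF _ _ tendsto_const LIMSEQ_inverse_real_of_nat])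
        (use td(1,2) in \<open>auto simp: less_imp_le\<close>)
    have "bounded (range d)" using td(4) by (auto simp: bounded_iff)
    then obtain l f where f: "strict_mono f" and lim: "(d \<circ> f) \<longlonglongrightarrow> l"
      using bounded_imp_convergent_subsequence by blast
    have tf: "(t \<circ> f) \<longlonglongrightarrow> 0" by (rule LIMSEQ_subseq_LIMSEQ[OF t0 f])
    have l: "DG l \<in> K"
      by (rule tangent_limit[of "t \<circ> f" "d \<circ> f"]) (use td tf lim in auto)
    \<comment> \<open>As the adjoint image of a polar vector, \<open>zs\<close> is nonpositive on
      the linearised cone; the estimate with \<open>C\<close> gives the reverse inequality in the
      limit.\<close>
    have "inner zs l \<le> 0"
    proof -
      have "inner \<mu> (DG l) = inner zs l"
        using \<mu> adjoint_clauses(2)[of "blinfun_apply DG" \<mu> l]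
        by (auto simp: mult_set_def bounded_linear.linear blinfun.bounded_linear_right)
      then show ?thesis using \<mu> l by (auto simp: mult_set_def polar_cone_def)
    qed
    moreover have "- inner zs l \<le> C * 0"
    proof (rule LIMSEQ_le[of "\<lambda>j. - inner zs ((d \<circ> f) j)" _ "\<lambda>j. C * (t \<circ> f) j"])
      show "(\<lambda>j. - inner zs ((d \<circ> f) j)) \<longlonglongrightarrow> - inner zs l" by (intro tendsto_intros lim)
      show "(\<lambda>j. C * (t \<circ> f) j) \<longlonglongrightarrow> C * 0" by (intro tendsto_intros tf)
    qed (use td(5) in auto)
    ultimately have "l \<in> critical_cone \<Omega> zb zs" using l by (simp add: critical_cone_eq)
    then have "inner n l \<le> 0" using n by (simp add: polar_cone_def)
    moreover have "e \<le> inner n l"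
    proof (rule LIMSEQ_le_const[of "\<lambda>j. inner n ((d \<circ> f) j)"])
      show "(\<lambda>j. inner n ((d \<circ> f) j)) \<longlonglongrightarrow> inner n l" by (intro tendsto_intros lim)
    qed (use td(6) in \<open>auto simp: less_imp_le\<close>)
    ultimately show False using \<open>e > 0\<close> by simp
  qed
  then show thesis using that by blast
qed

text \<open>The minimiser is written \<open>zb + t *\<^sub>R (v + x)\<close>. Comparison with a
  recovery point bounds \<open>(norm x)\<^sup>2\<close> by \<open>inner n x\<close> and small terms.
  Here \<open>inner n x = inner n d - inner n v\<close> with \<open>inner n d\<close> asymptotically
  nonpositive, so \<open>- inner n v < e\<^sup>2\<close> yields \<open>norm x \<le> e\<close>, and
  the normal errs by \<open>\<rho> *\<^sub>R (t *\<^sub>R x)\<close>.\<close>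

lemma approximate_normals:
  assumes v: "v \<in> critical_cone \<Omega> zb zs"
    and \<mu>: "\<mu> \<in> mult_set_dir DG D2G K zs v"
    and n: "n \<in> polar_cone (critical_cone \<Omega> zb zs)"
    and "e > 0" and ne: "- inner n v < e\<^sup>2"
  obtains \<delta> where "\<delta> > 0" "\<And>t. 0 < t \<Longrightarrow> t < \<delta> \<Longrightarrow>
    \<exists>z\<in>\<Omega>. \<exists>ns\<in>regular_normal_cone \<Omega> z. norm (z - zb - t *\<^sub>R v) \<le> e * t \<and>
      norm (ns - zs - t *\<^sub>R (adjoint (blinfun_apply (D2G v)) \<mu> + n)) \<le> (norm \<mu> * norm D2G + 2) * e * t"
proof -
  define hv where "hv = adjoint (blinfun_apply (D2G v)) \<mu>"
  have hv: "inner hv x = inner \<mu> (D2G v x)" for x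
    unfolding hv_def by (intro adjoint_clauses(2) bounded_linear.linear blinfun.bounded_linear_right)
  define ws where "ws = hv + n"
  define B where "B = norm \<mu> * norm D2G"
  have "B \<ge> 0" by (simp add: B_def)
  have B: "- inner \<mu> (D2G x x) \<le> B * (norm x)\<^sup>2" for x
  proof -
    have "- inner \<mu> (D2G x x) \<le> norm \<mu> * norm (D2G x x)"
      using norm_cauchy_schwarz[of "- \<mu>" "D2G x x"] by simp
    also have "\<dots> \<le> norm \<mu> * (norm D2G * norm x * norm x)"
      by (intro mult_left_mono D2G_bound) simp
    finally show ?thesis by (simp add: B_def power2_eq_square mult.assoc)
  qed
  \<comment> \<open>\<open>B\<close> offsets the possible concavity of the quadratic form of
    \<open>\<mu>\<close>; the added \<open>2\<close> leaves a full \<open>(norm x)\<^sup>2\<close>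
    after halving.\<close>
  define \<rho> where "\<rho> = B + 2"
  define m where "m = inner \<mu> (D2G v v)"
  \<comment> \<open>The minimum of \<open>J\<close> below is at most \<open>t\<^sup>2 * q\<close> up
    to \<open>t\<^sup>2 * e2\<close>.\<close>
  define q where "q = m / 2 - inner ws v"
  \<comment> \<open>\<open>g\<close> is the room left by the bound on \<open>- inner n v\<close>;
    three errors of at most \<open>g / 4\<close> each will fit into it.\<close>
  define g where "g = e\<^sup>2 + inner n v"
  have "g > 0" using ne by (simp add: g_def)
  define X where "X = 2 * norm n + 2 + (norm v)\<^sup>2"
  define R where "R = X + norm v"
  have "X \<ge> 1" "R \<ge> 1" by (simp_all add: X_def R_def add_nonneg_nonneg add_increasing2)
  \<comment> \<open>The bound \<open>1 / 4\<close> lets half of \<open>(norm x)\<^sup>2\<close>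
    absorb the quadratic error in the a priori estimate \<open>norm x \<le> X\<close>. The bound
    \<open>g / (4 * R\<^sup>2)\<close> makes this error at most \<open>g / 4\<close> once
    \<open>norm d \<le> R\<close> is known.\<close>
  define e1 where "e1 = min (1 / 4) (g / (4 * R\<^sup>2))"
  define e2 where "e2 = min 1 (g / 4)"
  have "e1 > 0" "e2 > 0" using \<open>g > 0\<close> \<open>R \<ge> 1\<close> by (simp_all add: e1_def e2_def)
  define C where "C = q + 1 + norm ws * R"
  have \<mu>m: "\<mu> \<in> mult_set DG K zs" and max: "\<And>\<nu>. \<nu> \<in> mult_set DG K zs \<Longrightarrow> inner \<nu> (D2G v v) \<le> m"
    using \<mu> by (auto simp: mult_set_dir_def m_def)
  have v': "DG v \<in> K" "inner zs v = 0" using v by (simp_all add: critical_cone_eq)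
  obtain M \<delta>1 where "M \<ge> 0" "\<delta>1 > 0" and \<delta>1: "\<And>t. 0 < t \<Longrightarrow> t < \<delta>1 \<Longrightarrow>
    \<exists>z\<in>\<Omega>. norm (z - zb - t *\<^sub>R v) \<le> M * t\<^sup>2 \<and> - inner zs (z - zb) \<le> t\<^sup>2 / 2 * (m + e2)"
    using recovery_curve[OF v' max \<open>e2 > 0\<close>] by blast
  obtain \<delta>2 where "\<delta>2 > 0" and \<delta>2: "\<And>z. z \<in> \<Omega> \<Longrightarrow> norm (z - zb) < \<delta>2 \<Longrightarrow>
    inner \<mu> (D2G (z - zb) (z - zb)) / 2 - e1 * (norm (z - zb))\<^sup>2 \<le> - inner zs (z - zb)"
    using curvature_lower_bound[OF \<mu>m \<open>e1 > 0\<close>] by blast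
  obtain \<delta>3 where "\<delta>3 > 0" and \<delta>3: "\<And>t d. 0 < t \<Longrightarrow> t < \<delta>3 \<Longrightarrow> zb + t *\<^sub>R d \<in> \<Omega> \<Longrightarrow> norm d \<le> R \<Longrightarrow>
    - inner zs d \<le> C * t \<Longrightarrow> inner n d \<le> g / 4"
    using polar_critical_bound[OF n \<mu>m, of "g / 4" R C] \<open>g > 0\<close> by (metis divide_pos_pos zero_less_numeral)
  obtain r where "r > 0" and r: "compact (\<Omega> \<inter> cball zb r)" using locally_compact by blast
  define r0 where "r0 = min r (\<delta>2 / 2)"
  have "r0 > 0" "r0 < \<delta>2" using \<open>r > 0\<close> \<open>\<delta>2 > 0\<close> by (auto simp: r0_def)
  have "\<Omega> \<inter> cball zb r0 = (\<Omega> \<inter> cball zb r) \<inter> cball zb r0" by (auto simp: r0_def)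
  then have comp: "compact (\<Omega> \<inter> cball zb r0)" using r by (simp add: compact_Int_closed)
  define N where "N = norm ws * M + \<rho> / 2 * M\<^sup>2"
  have "N \<ge> 0" using \<open>M \<ge> 0\<close> \<open>B \<ge> 0\<close> by (simp add: N_def \<rho>_def)
  define c where "c = norm v + M + 1"
  have "c > 0" using \<open>M \<ge> 0\<close> by (simp add: c_def add_nonneg_pos)
  define \<delta> where "\<delta> = Min {1, \<delta>1, \<delta>3, e2 / (2 * (N + 1)), r0 / c, r0 / R}"
  have "\<delta> > 0"
    using \<open>\<delta>1 > 0\<close> \<open>\<delta>3 > 0\<close> \<open>e2 > 0\<close> \<open>N \<ge> 0\<close> \<open>r0 > 0\<close> \<open>c > 0\<close> \<open>R \<ge> 1\<close> by (simp add: \<delta>_def)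
  show thesis
  proof (rule that[OF \<open>\<delta> > 0\<close>])
    fix t assume t: "0 < t" "t < \<delta>"
    then have t': "t < 1" "t < \<delta>1" "t < \<delta>3" "t < e2 / (2 * (N + 1))" "t < r0 / c" "t < r0 / R"
      by (simp_all add: \<delta>_def)
    define J where "J z = - inner (zs + t *\<^sub>R ws) (z - zb) + \<rho> / 2 * (norm (z - zb - t *\<^sub>R v))\<^sup>2" for z
    obtain y where y: "y \<in> \<Omega>" "norm (y - zb - t *\<^sub>R v) \<le> M * t\<^sup>2" "- inner zs (y - zb) \<le> t\<^sup>2 / 2 * (m + e2)"
      using \<delta>1[OF t(1) t'(2)] by blast
    have tt: "t\<^sup>2 \<le> t" using t(1) t'(1) by (simp add: power2_eq_square)
    have Jy: "J y \<le> t\<^sup>2 * (q + e2)"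
    proof -
      have "- inner ws (y - zb - t *\<^sub>R v) \<le> norm ws * norm (y - zb - t *\<^sub>R v)"
        using norm_cauchy_schwarz[of "- ws" "y - zb - t *\<^sub>R v"] by simp
      also have "\<dots> \<le> norm ws * (M * t\<^sup>2)" using y(2) by (intro mult_left_mono) auto
      finally have a: "- t * inner ws (y - zb) \<le> - t\<^sup>2 * inner ws v + t * (norm ws * (M * t\<^sup>2))"
        using t(1) mult_left_mono[of "- inner ws (y - zb - t *\<^sub>R v)" "norm ws * (M * t\<^sup>2)" t]
        by (simp add: inner_diff_right power2_eq_square algebra_simps)
      have "(norm (y - zb - t *\<^sub>R v))\<^sup>2 \<le> (M * t\<^sup>2)\<^sup>2" using y(2) by (intro power_mono) auto
      also have "\<dots> = M\<^sup>2 * (t\<^sup>2 * t\<^sup>2)" by (simp add: power_mult_distrib power2_eq_square)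
      also have "\<dots> \<le> M\<^sup>2 * (t\<^sup>2 * t)" using tt by (intro mult_left_mono) auto
      finally have b: "\<rho> / 2 * (norm (y - zb - t *\<^sub>R v))\<^sup>2 \<le> \<rho> / 2 * (M\<^sup>2 * (t\<^sup>2 * t))"
        using \<open>B \<ge> 0\<close> by (intro mult_left_mono) (auto simp: \<rho>_def)
      have "t * (2 * (N + 1)) < e2" using t'(4) \<open>N \<ge> 0\<close> by (simp add: pos_less_divide_eq)
      then have "t * N \<le> e2 / 2" using t(1) by (simp add: distrib_left)
      then have c: "t\<^sup>2 * (t * N) \<le> t\<^sup>2 * (e2 / 2)" by (rule mult_left_mono) simp
      have "J y = - inner zs (y - zb) + (- t * inner ws (y - zb)) + \<rho> / 2 * (norm (y - zb - t *\<^sub>R v))\<^sup>2"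
        by (simp add: J_def inner_add_left)
      also have "\<dots> \<le> t\<^sup>2 / 2 * (m + e2) + (- t\<^sup>2 * inner ws v + t * (norm ws * (M * t\<^sup>2)))
          + \<rho> / 2 * (M\<^sup>2 * (t\<^sup>2 * t))"
        by (intro add_mono y(3) a b)
      also have "\<dots> = t\<^sup>2 / 2 * (m + e2) - t\<^sup>2 * inner ws v + t\<^sup>2 * (t * N)"
        by (simp add: N_def algebra_simps)
      also have "\<dots> \<le> t\<^sup>2 / 2 * (m + e2) - t\<^sup>2 * inner ws v + t\<^sup>2 * (e2 / 2)"
        using c by simp
      also have "\<dots> = t\<^sup>2 * (q + e2)" by (simp add: q_def field_simps)
      finally show ?thesis .
    qed
    have "norm (y - zb) \<le> norm (y - zb - t *\<^sub>R v) + norm (t *\<^sub>R v)"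
      using norm_triangle_ineq[of "y - zb - t *\<^sub>R v" "t *\<^sub>R v"] by simp
    also have "\<dots> \<le> M * t + t * norm v"
      using y(2) t(1) mult_left_mono[OF tt \<open>M \<ge> 0\<close>] by simp
    also have "\<dots> \<le> t * c" using t(1) by (simp add: c_def algebra_simps)
    also have "\<dots> < r0" using t'(5) \<open>c > 0\<close> by (simp add: pos_less_divide_eq)
    finally have yball: "y \<in> \<Omega> \<inter> cball zb r0"
      using y(1) by (simp add: dist_norm norm_minus_commute)
    have "continuous_on (\<Omega> \<inter> cball zb r0) J" unfolding J_def by (intro continuous_intros)
    then obtain z where z: "z \<in> \<Omega> \<inter> cball zb r0" and min: "\<And>x. x \<in> \<Omega> \<inter> cball zb r0 \<Longrightarrow> J z \<le> J x"
      using continuous_attains_inf[OF comp] yball by blast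
    have Jz: "J z \<le> t\<^sup>2 * (q + e2)" using min[OF yball] Jy by simp
    define d where "d = inverse t *\<^sub>R (z - zb)"
    define x where "x = d - v"
    have zd: "z - zb = t *\<^sub>R d" using t(1) by (simp add: d_def)
    have zx: "z - zb - t *\<^sub>R v = t *\<^sub>R x" by (simp add: zd x_def scaleR_diff_right)
    have d: "d = v + x" by (simp add: x_def)
    have Jd: "J z = - inner zs (z - zb) - t\<^sup>2 * inner ws d + t\<^sup>2 * (\<rho> / 2 * (norm x)\<^sup>2)"
      unfolding J_def zx by (simp add: zd inner_add_left power_mult_distrib power2_eq_square algebra_simps)
    \<comment> \<open>Expanding the quadratic form at \<open>v\<close> produces the linear term
      \<open>inner hv x\<close>, which the tilt \<open>hv\<close> contained in \<open>ws\<close>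
      cancels exactly; the constants cancel against \<open>q\<close>.\<close>
    have key: "(norm x)\<^sup>2 \<le> inner n x + e1 * (norm d)\<^sup>2 + e2"
    proof -
      have "t\<^sup>2 * (inner \<mu> (D2G d d) / 2 - e1 * (norm d)\<^sup>2)
          = inner \<mu> (D2G (z - zb) (z - zb)) / 2 - e1 * (norm (z - zb))\<^sup>2"
        by (simp add: zd blinfun.bilinear_simps power_mult_distrib power2_eq_square algebra_simps)
      also have "\<dots> \<le> - inner zs (z - zb)"
        by (rule \<delta>2) (use z \<open>r0 < \<delta>2\<close> in \<open>auto simp: dist_norm norm_minus_commute\<close>)
      finally have "t\<^sup>2 * (inner \<mu> (D2G d d) / 2 - e1 * (norm d)\<^sup>2 - inner ws d + \<rho> / 2 * (norm x)\<^sup>2) \<le> J z"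
        by (simp add: Jd algebra_simps)
      also note Jz
      finally have low: "inner \<mu> (D2G d d) / 2 - e1 * (norm d)\<^sup>2 - inner ws d + \<rho> / 2 * (norm x)\<^sup>2 \<le> q + e2"
        using t(1) by simp
      have "inner \<mu> (D2G d d) = m + 2 * inner hv x + inner \<mu> (D2G x x)"
        by (simp add: d m_def hv blinfun.bilinear_simps inner_add_right symmetric[of x v])
      moreover have "inner ws d = inner ws v + inner hv x + inner n x"
        by (simp add: d ws_def inner_simps)
      moreover have "\<rho> / 2 * (norm x)\<^sup>2 = B * (norm x)\<^sup>2 / 2 + (norm x)\<^sup>2"
        by (simp add: \<rho>_def algebra_simps)
      ultimately show ?thesis using low B[of x] unfolding q_def by argo
    qed
    \<comment> \<open>A coarse bound comes first because \<open>polar_critical_bound\<close> is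
      uniform only over \<open>norm d \<le> R\<close>. Beyond \<open>X \<ge> 1\<close> the constants
      are dominated by multiples of \<open>norm x\<close>, which contradicts
      \<open>key\<close>.\<close>
    have xX: "norm x \<le> X"
    proof (rule ccontr)
      assume "\<not> norm x \<le> X"
      then have gt: "X < norm x" by simp
      have "norm d \<le> norm v + norm x" unfolding d by (rule norm_triangle_ineq)
      then have "(norm d)\<^sup>2 \<le> (norm v + norm x)\<^sup>2" by (rule power_mono) simp
      also have "\<dots> \<le> 2 * (norm v)\<^sup>2 + 2 * (norm x)\<^sup>2"
        using sum_squares_bound[of "norm v" "norm x"] by (simp add: power2_sum)
      finally have dd: "(norm d)\<^sup>2 \<le> 2 * (norm v)\<^sup>2 + 2 * (norm x)\<^sup>2" .
      have "e1 * (norm d)\<^sup>2 \<le> 1 / 4 * (norm d)\<^sup>2" by (rule mult_right_mono) (simp_all add: e1_def)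
      moreover have "inner n x \<le> norm n * norm x" by (rule norm_cauchy_schwarz)
      moreover have "e2 \<le> 1" by (simp add: e2_def)
      ultimately have "(norm x)\<^sup>2 \<le> 2 * (norm n * norm x) + (norm v)\<^sup>2 + 2"
        using key dd by argo
      also have "\<dots> \<le> 2 * (norm n * norm x) + ((norm v)\<^sup>2 + 2) * norm x"
        using gt \<open>X \<ge> 1\<close> mult_left_mono[of 1 "norm x" "(norm v)\<^sup>2 + 2"] by simp
      also have "\<dots> = X * norm x" by (simp add: X_def algebra_simps)
      also have "\<dots> < norm x * norm x" using gt \<open>X \<ge> 1\<close> by (intro mult_strict_right_mono) auto
      finally show False by (simp add: power2_eq_square)
    qed
    then have dR: "norm d \<le> R" unfolding d R_def using norm_triangle_ineq[of v x] by simp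
    \<comment> \<open>Optimality also bounds \<open>- inner zs d\<close> by \<open>C * t\<close>,
      the condition under which \<open>\<delta>3\<close> controls \<open>inner n d\<close>.\<close>
    have "- inner zs (z - zb) \<le> t\<^sup>2 * (q + e2) + t\<^sup>2 * inner ws d"
    proof -
      have "0 \<le> t\<^sup>2 * (\<rho> / 2 * (norm x)\<^sup>2)" using \<open>B \<ge> 0\<close> by (simp add: \<rho>_def)
      then show ?thesis using Jz Jd by linarith
    qed
    also have "\<dots> = t\<^sup>2 * (q + e2 + inner ws d)" by (simp add: distrib_left)
    also have "\<dots> \<le> t\<^sup>2 * C"
    proof (rule mult_left_mono)
      have "inner ws d \<le> norm ws * R"
        using norm_cauchy_schwarz[of ws d] mult_left_mono[OF dR, of "norm ws"] by simp
      then show "q + e2 + inner ws d \<le> C" by (simp add: C_def e2_def)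
    qed simp
    finally have "t * (- inner zs d) \<le> t * (C * t)" by (simp add: zd power2_eq_square mult_ac)
    then have "- inner zs d \<le> C * t" using t(1) by (simp only: mult_le_cancel_left_pos)
    moreover have "zb + t *\<^sub>R d \<in> \<Omega>" using z by (simp add: zd[symmetric])
    ultimately have "inner n d \<le> g / 4" using \<delta>3 t(1) t'(3) dR by blast
    moreover have "e1 * (norm d)\<^sup>2 \<le> g / 4"
    proof -
      have "e1 * (norm d)\<^sup>2 \<le> g / (4 * R\<^sup>2) * R\<^sup>2"
        using dR \<open>g > 0\<close> \<open>e1 > 0\<close> by (intro mult_mono power_mono) (auto simp: e1_def)
      then show ?thesis using \<open>R \<ge> 1\<close> by simp
    qed
    moreover have "e2 \<le> g / 4" by (simp add: e2_def)
    moreover have "inner n x = inner n d - inner n v" by (simp add: x_def inner_diff_right)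
    ultimately have "(norm x)\<^sup>2 \<le> e\<^sup>2" using key \<open>g > 0\<close> unfolding g_def by argo
    then have xe: "norm x \<le> e" by (rule power2_le_imp_le) (use \<open>e > 0\<close> in simp)
    have "norm (z - zb) \<le> t * R" using dR t(1) by (simp add: zd)
    also have "\<dots> < r0" using t'(6) \<open>R \<ge> 1\<close> by (simp add: pos_less_divide_eq)
    finally have inner: "norm (z - zb) < r0" .
    \<comment> \<open>The minimiser is interior to the ball, hence a local minimiser over
      \<open>\<Omega>\<close> itself; the radius \<open>r0 - norm (z - zb)\<close> keeps the
      competitors inside the ball.\<close>
    have "(zs + t *\<^sub>R ws) - \<rho> *\<^sub>R (z - (zb + t *\<^sub>R v)) \<in> regular_normal_cone \<Omega> z"
    proof (rule regular_normal_of_local_min)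
      show "z \<in> \<Omega>" using z by simp
      show "r0 - norm (z - zb) > 0" using inner by simp
      show "\<rho> \<ge> 0" using \<open>B \<ge> 0\<close> by (simp add: \<rho>_def)
      fix x assume x: "x \<in> \<Omega>" "norm (x - z) < r0 - norm (z - zb)"
      have "norm (x - zb) \<le> norm (x - z) + norm (z - zb)"
        using norm_triangle_ineq[of "x - z" "z - zb"] by simp
      then have "J z \<le> J x" using x by (intro min) (simp add: dist_norm norm_minus_commute)
      then show "\<rho> / 2 * (norm (z - (zb + t *\<^sub>R v)))\<^sup>2 - inner (zs + t *\<^sub>R ws) z
          \<le> \<rho> / 2 * (norm (x - (zb + t *\<^sub>R v)))\<^sup>2 - inner (zs + t *\<^sub>R ws) x"
        by (simp add: J_def inner_diff_right diff_diff_eq)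
    qed
    moreover have "norm (z - zb - t *\<^sub>R v) \<le> e * t"
      unfolding zx using xe t(1) by (simp add: mult.commute)
    moreover have "norm ((zs + t *\<^sub>R ws) - \<rho> *\<^sub>R (z - (zb + t *\<^sub>R v)) - zs - t *\<^sub>R (hv + n)) \<le> \<rho> * e * t"
    proof -
      have "(zs + t *\<^sub>R ws) - \<rho> *\<^sub>R (z - (zb + t *\<^sub>R v)) - zs - t *\<^sub>R (hv + n) = - (\<rho> *\<^sub>R (t *\<^sub>R x))"
        unfolding zx[symmetric] ws_def by (simp add: diff_diff_eq)
      then show ?thesis using xe t(1) \<open>B \<ge> 0\<close> by (simp add: \<rho>_def mult.assoc mult.commute[of t])
    qed
    ultimately show "\<exists>z\<in>\<Omega>. \<exists>ns\<in>regular_normal_cone \<Omega> z. norm (z - zb - t *\<^sub>R v) \<le> e * t \<and>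
        norm (ns - zs - t *\<^sub>R (adjoint (blinfun_apply (D2G v)) \<mu> + n)) \<le> (norm \<mu> * norm D2G + 2) * e * t"
      using z unfolding hv_def \<rho>_def B_def by blast
  qed
qed

end

subsection \<open>Partial adjoints and the reduction\<close>

text \<open>Test points with the same parameter have increments \<open>(0, x - snd z)\<close>, which
  see only the second component of the normal.\<close>

lemma regular_normal_cone_slice:
  assumes "ns \<in> regular_normal_cone (gph_Gamma g C) z"
  shows "snd ns \<in> regular_normal_cone (Gam g C (fst z)) (snd z)"
  unfolding regular_normal_cone_def
proof (intro CollectI conjI allI impI)
  show "snd z \<in> Gam g C (fst z)"
    using assms by (auto simp: regular_normal_cone_def gph_Gamma_def Gam_def)
  fix e :: real assume "e > 0"
  then obtain \<delta> where "\<delta> > 0" and \<delta>: "\<And>y. y \<in> gph_Gamma g C \<Longrightarrow> 0 < norm (y - z) \<Longrightarrow> norm (y - z) < \<delta> \<Longrightarrow>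
      inner ns (y - z) \<le> e * norm (y - z)"
    using assms unfolding regular_normal_cone_def by blast
  have "inner (snd ns) (x - snd z) \<le> e * norm (x - snd z)"
    if "x \<in> Gam g C (fst z)" "0 < norm (x - snd z)" "norm (x - snd z) < \<delta>" for x
  proof -
    have y: "(fst z, x) - z = (0, x - snd z)" by (simp add: prod_eq_iff)
    show ?thesis
      using \<delta>[of "(fst z, x)"] that unfolding y by (simp add: gph_Gamma_def Gam_def inner_prod_def norm_Pair)
  qed
  then show "\<exists>\<delta>>0. \<forall>x\<in>Gam g C (fst z). 0 < norm (x - snd z) \<and> norm (x - snd z) < \<delta> \<longrightarrow>
      inner (snd ns) (x - snd z) \<le> e * norm (x - snd z)"
    using \<open>\<delta> > 0\<close> by blast
qed

text \<open>\<open>adjoint\<close> is defined by choice; the coordinate formula exhibits its linear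
  dependence on \<open>f\<close>, so that it can be differentiated in a parameter.\<close>

lemma adjoint_eq_sum:
  fixes f :: "'n::euclidean_space \<Rightarrow> 'm::euclidean_space"
  assumes "linear f"
  shows "adjoint f y = (\<Sum>b\<in>Basis. inner (f b) y *\<^sub>R b)"
  using euclidean_representation[of "adjoint f y"] by (simp add: inner_commute adjoint_works[OF assms])

lemma linear_blinfun_Pair: "linear (\<lambda>d. blinfun_apply A (0, d))"
  by (intro linearI) (simp_all add: blinfun.add_right[symmetric] blinfun.scaleR_right[symmetric])

lemma has_derivative_partial_adjoint:
  fixes G' :: "'a::real_normed_vector \<Rightarrow> ('p::real_normed_vector \<times> 'x::euclidean_space) \<Rightarrow>\<^sub>L 'e::euclidean_space"
  assumes "(G' has_derivative blinfun_apply G'') (at z)"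
  shows "((\<lambda>z. adjoint (\<lambda>d. blinfun_apply (G' z) (0, d)) \<mu>) has_derivative
    (\<lambda>v. adjoint (\<lambda>d. blinfun_apply (blinfun_apply G'' v) (0, d)) \<mu>)) (at z)"
  unfolding adjoint_eq_sum[OF linear_blinfun_Pair]
  by (intro derivative_intros bounded_linear.has_derivative[OF blinfun.bounded_linear_left] assms)

lemma snd_adjoint:
  fixes A :: "('p::euclidean_space \<times> 'x::euclidean_space) \<Rightarrow>\<^sub>L 'e::euclidean_space"
  shows "snd (adjoint (blinfun_apply A) \<mu>) = adjoint (\<lambda>d. blinfun_apply A (0, d)) \<mu>"
proof -
  have "inner d (snd (adjoint (blinfun_apply A) \<mu>)) = inner d (adjoint (\<lambda>d. blinfun_apply A (0, d)) \<mu>)" for d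
  proof -
    have "inner d (snd (adjoint (blinfun_apply A) \<mu>)) = inner (0, d) (adjoint (blinfun_apply A) \<mu>)"
      by (simp add: inner_prod_def)
    also have "\<dots> = inner (blinfun_apply A (0, d)) \<mu>"
      by (intro adjoint_works bounded_linear.linear blinfun.bounded_linear_right)
    also have "\<dots> = inner d (adjoint (\<lambda>d. blinfun_apply A (0, d)) \<mu>)"
      by (rule adjoint_works[OF linear_blinfun_Pair, symmetric])
    finally show ?thesis .
  qed
  then show ?thesis using vector_eq_ldot by blast
qed

text \<open>On a small closed ball \<open>g\<close> maps into \<open>V\<close>, where membership in
  \<open>C\<close> is membership of the \<open>h\<close>-image in \<open>K\<close>; continuity of
  \<open>g\<close> on that ball gives local compactness.\<close>

lemma cone_constraint_reduction:
  fixes g :: "'z::euclidean_space \<Rightarrow> 'y::euclidean_space" and h :: "'y \<Rightarrow> 'e::euclidean_space"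
  assumes g: "C2_on Ug g" "zb \<in> Ug"
    and C: "closed C" and K: "closed K" "convex K" "cone K"
    and V: "open V" "g zb \<in> V" and h0: "h (g zb) = 0"
    and red: "C \<inter> V = {y \<in> V. h y \<in> K}" and zb: "g zb \<in> C"
    and W: "open W" "zb \<in> W"
    and G': "\<And>z. z \<in> W \<Longrightarrow> ((h \<circ> g) has_derivative blinfun_apply (G' z)) (at z)"
    and G'': "(G' has_derivative blinfun_apply G'') (at zb)"
    and mscq: "MSCQ (h \<circ> g) K zb"
  shows "cone_constraint (g -` C) (h \<circ> g) K zb (G' zb) G''"
proof -
  obtain g' where Ug: "open Ug" and g': "\<And>z. z \<in> Ug \<Longrightarrow> (g has_derivative blinfun_apply (g' z)) (at z)"
    using g(1) unfolding C2_on_def by blast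
  have contg: "continuous_on Ug g"
    by (rule has_derivative_continuous_on) (rule has_derivative_at_withinI[OF g'])
  have "open (Ug \<inter> g -` V)" by (rule continuous_open_preimage[OF contg Ug V(1)])
  then obtain r where "r > 0" and r: "cball zb r \<subseteq> Ug \<inter> g -` V"
    using g(2) V(2) open_contains_cball by blast
  have loc: "z \<in> g -` C \<longleftrightarrow> (h \<circ> g) z \<in> K" if "norm (z - zb) < r" for z
  proof -
    have "z \<in> cball zb r" using that by (simp add: dist_norm norm_minus_commute)
    then have "g z \<in> V" using r by auto
    then show ?thesis using red by auto
  qed
  have "closed (cball zb r \<inter> g -` C)"
    by (rule continuous_closed_preimage[OF continuous_on_subset[OF contg] closed_cball C]) (use r in auto)
  then have "compact (cball zb r \<inter> (cball zb r \<inter> g -` C))"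
    by (rule compact_Int_closed[OF compact_cball])
  moreover have "cball zb r \<inter> (cball zb r \<inter> g -` C) = g -` C \<inter> cball zb r" by auto
  ultimately have comp: "compact (g -` C \<inter> cball zb r)" by simp
  \<comment> \<open>\<open>cone\<close> also holds for the empty set; the base point supplies
    \<open>0 = h (g zb)\<close> as an element of \<open>K\<close>.\<close>
  have K0: "0 \<in> K" using red zb V(2) h0 by (metis (mono_tags, lifting) IntI mem_Collect_eq)
  show ?thesis
  proof
    show "\<exists>r>0. compact (g -` C \<inter> cball zb r)" using \<open>r > 0\<close> comp by blast
    show "\<exists>r>0. \<forall>z. norm (z - zb) < r \<longrightarrow> (z \<in> g -` C) = ((h \<circ> g) z \<in> K)" using \<open>r > 0\<close> loc by blast
    show "\<exists>\<delta>>0. \<forall>k. norm k < \<delta> \<longrightarrow>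
        norm ((h \<circ> g) (zb + k) - G' zb k - (1/2) *\<^sub>R G'' k k) \<le> e * (norm k)\<^sup>2" if e: "e > 0" for e
      using second_order_expansion[OF W G' G'' e] h0 by auto
    show "G'' x y = G'' y x" for x y by (rule second_derivative_symmetric[OF W G' G''])
  qed (use K K0 zb mscq in auto)
qed

section \<open>Tangents to the graph of the normal cone mapping\<close>

theorem theorem3p3:
  fixes g :: "'p::euclidean_space \<times> 'x::euclidean_space \<Rightarrow> 'y::euclidean_space"
    and h :: "'y \<Rightarrow> 'e::euclidean_space"
    and C :: "'y set" and K :: "'e set" and V :: "'y set"
    and pb :: 'p and xb :: 'x and xbs :: 'x
    and G' :: "'p \<times> 'x \<Rightarrow> ('p \<times> 'x) \<Rightarrow>\<^sub>L 'e"
    and G'' :: "'p \<times> 'x \<Rightarrow> ('p \<times> 'x) \<Rightarrow>\<^sub>L ('p \<times> 'x) \<Rightarrow>\<^sub>L 'e"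
    and h' :: "'y \<Rightarrow> 'y \<Rightarrow>\<^sub>L 'e"
    and Ug Wg :: "('p \<times> 'x) set"
    and zs :: "'p \<times> 'x" and q :: 'p and u :: 'x and \<mu> :: 'e and wx :: 'x
  assumes g_C2: "C2_on Ug g" and zb_Ug: "(pb, xb) \<in> Ug"
    and C_closed: "closed C"
    and K_closed: "closed K" and K_convex: "convex K" and K_cone: "cone K"
    and V_open: "open V" and gzb_V: "g (pb, xb) \<in> V"
    and h_C2: "C2_on V h"
    and h_zero: "h (g (pb, xb)) = 0"
    and h'_deriv: "(h has_derivative blinfun_apply (h' (g (pb, xb)))) (at (g (pb, xb)))"
    and h'_surj: "surj (blinfun_apply (h' (g (pb, xb))))"
    and C_red: "C \<inter> V = {y \<in> V. h y \<in> K}"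
    and xb_in: "xb \<in> Gam g C pb"
    and xbs_in: "xbs \<in> regular_normal_cone (Gam g C pb) xb"
    and Wg_open: "open Wg" and zb_Wg: "(pb, xb) \<in> Wg"
    and G'_deriv: "\<forall>z\<in>Wg. ((h \<circ> g) has_derivative blinfun_apply (G' z)) (at z)"
    and G''_deriv: "\<forall>z\<in>Wg. (G' has_derivative blinfun_apply (G'' z)) (at z)"
    and mscq: "MSCQ (h \<circ> g) K (pb, xb)"
    and zs_in: "zs \<in> regular_normal_cone (gph_Gamma g C) (pb, xb)"
    and zs_proj: "snd zs = xbs"
    and v_crit: "(q, u) \<in> critical_cone (gph_Gamma g C) (pb, xb) zs"
    and mu_in: "\<mu> \<in> mult_set_dir (G' (pb, xb)) (G'' (pb, xb)) K zs (q, u)"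
    and wx_lim: "\<exists>wk :: nat \<Rightarrow> 'p \<times> 'x.
        (\<forall>k. wk k \<in> polar_cone (critical_cone (gph_Gamma g C) (pb, xb) zs)) \<and>
        (\<lambda>k. snd (wk k)) \<longlonglongrightarrow> wx \<and> (\<lambda>k. inner (wk k) (q, u)) \<longlonglongrightarrow> 0"
  shows "(let D = frechet_derivative (\<lambda>z. adjoint (\<lambda>d. blinfun_apply (G' z) (0, d)) \<mu>)
                    (at (pb, xb)) (q, u)
          in ((q, u), D + wx) \<in> tangent_cone (gph_Psi g C) ((pb, xb), xbs) \<and>
             derivable_tangent (gph_Psi g C) ((pb, xb), xbs) ((q, u), D + wx) \<and>
             (\<forall>ws \<in> regular_normal_cone (critical_cone (gph_Gamma g C) (pb, xb) zs) (q, u).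
                ((q, u), D + snd ws) \<in> tangent_cone (gph_Psi g C) ((pb, xb), xbs)))"
proof -
  define zb where "zb = (pb, xb)"
  define v where "v = (q, u)"
  note fold = zb_def[symmetric] v_def[symmetric]
  define DG where "DG = G' zb"
  define D2G where "D2G = G'' zb"
  have \<Omega>: "gph_Gamma g C = g -` C" by (auto simp: gph_Gamma_def)
  interpret cone_constraint "gph_Gamma g C" "h \<circ> g" K zb DG D2G
    unfolding \<Omega> DG_def D2G_def
    by (rule cone_constraint_reduction[OF g_C2 _ C_closed K_closed K_convex K_cone V_open _ _ C_red _ Wg_open])
      (use assms in \<open>auto simp: zb_def Gam_def\<close>)
  define D where "D = adjoint (\<lambda>d. blinfun_apply (D2G v) (0, d)) \<mu>"
  have "(G' has_derivative blinfun_apply D2G) (at zb)"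
    using G''_deriv zb_Wg by (simp add: zb_def D2G_def)
  from has_derivative_partial_adjoint[OF this]
  have D: "frechet_derivative (\<lambda>z. adjoint (\<lambda>d. blinfun_apply (G' z) (0, d)) \<mu>) (at zb) v = D"
    unfolding D_def by (metis frechet_derivative_at)
  have sndD: "snd (adjoint (blinfun_apply (D2G v)) \<mu>) = D" by (simp add: D_def snd_adjoint)
  have v: "v \<in> critical_cone (gph_Gamma g C) zb zs" using v_crit by (simp add: fold)
  have \<mu>: "\<mu> \<in> mult_set_dir DG D2G K zs v" using mu_in by (simp add: fold DG_def D2G_def)
  define \<rho> where "\<rho> = norm \<mu> * norm D2G + 2"
  have "\<rho> \<ge> 0" by (simp add: \<rho>_def)
  \<comment> \<open>Arbitrary sequences cover both claims: for a normal to the critical cone the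
    sequence is constant.\<close>
  have main: "derivable_tangent (gph_Psi g C) (zb, xbs) (v, D + w)"
    if wk: "\<And>k. wk k \<in> polar_cone (critical_cone (gph_Gamma g C) zb zs)"
      and lim: "(\<lambda>k. snd (wk k)) \<longlonglongrightarrow> w" "(\<lambda>k. inner (wk k) v) \<longlonglongrightarrow> 0"
    for wk :: "nat \<Rightarrow> 'p \<times> 'x" and w
  proof (rule derivable_tangentI)
    show "(zb, xbs) \<in> gph_Psi g C" using xbs_in by (simp add: gph_Psi_def zb_def)
    fix e :: real assume "e > 0"
    \<comment> \<open>The normal contributes \<open>\<rho> * e' * t\<close>; the base point and the
      distance of \<open>snd (wk k)\<close> from \<open>w\<close> contribute \<open>e' * t\<close>
      each.\<close>
    define e' where "e' = e / (\<rho> + 2)"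
    have "e' > 0" using \<open>e > 0\<close> \<open>\<rho> \<ge> 0\<close> by (simp add: e'_def)
    have "\<forall>\<^sub>F k in sequentially. dist (snd (wk k)) w < e'" by (rule tendstoD[OF lim(1) \<open>e' > 0\<close>])
    moreover have "\<forall>\<^sub>F k in sequentially. - e'\<^sup>2 < inner (wk k) v"
      by (rule order_tendstoD(1)[OF lim(2)]) (use \<open>e' > 0\<close> in simp)
    ultimately have "\<forall>\<^sub>F k in sequentially. dist (snd (wk k)) w < e' \<and> - e'\<^sup>2 < inner (wk k) v"
      by (rule eventually_conj)
    \<comment> \<open>\<open>derivable_tangentI\<close> treats each tolerance separately, so
      \<open>k\<close> may depend on \<open>e\<close>, and the polar vector \<open>wk k\<close>
      stays fixed while \<open>t\<close> tends to \<open>0\<close>.\<close>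
    then obtain k where k: "dist (snd (wk k)) w < e'" "- inner (wk k) v < e'\<^sup>2"
      using eventually_happens' sequentially_bot by fastforce
    obtain \<delta> where "\<delta> > 0" and \<delta>: "\<And>t. 0 < t \<Longrightarrow> t < \<delta> \<Longrightarrow>
      \<exists>z\<in>gph_Gamma g C. \<exists>ns\<in>regular_normal_cone (gph_Gamma g C) z. norm (z - zb - t *\<^sub>R v) \<le> e' * t \<and>
        norm (ns - zs - t *\<^sub>R (adjoint (blinfun_apply (D2G v)) \<mu> + wk k)) \<le> \<rho> * e' * t"
      using approximate_normals[OF v \<mu> wk \<open>e' > 0\<close> k(2)] unfolding \<rho>_def by blast
    have "\<exists>y\<in>gph_Psi g C. norm (y - (zb, xbs) - t *\<^sub>R (v, D + w)) \<le> e * t" if t: "0 < t" "t < \<delta>" for t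
    proof -
      obtain z ns where z: "ns \<in> regular_normal_cone (gph_Gamma g C) z" "norm (z - zb - t *\<^sub>R v) \<le> e' * t"
        "norm (ns - zs - t *\<^sub>R (adjoint (blinfun_apply (D2G v)) \<mu> + wk k)) \<le> \<rho> * e' * t"
        using \<delta>[OF t] by blast
      have "snd ns - xbs - t *\<^sub>R (D + w)
          = snd (ns - zs - t *\<^sub>R (adjoint (blinfun_apply (D2G v)) \<mu> + wk k)) + t *\<^sub>R (snd (wk k) - w)"
        by (simp add: zs_proj sndD algebra_simps)
      also have "norm \<dots> \<le> \<rho> * e' * t + t * e'"
      proof (rule norm_triangle_mono)
        show "norm (snd (ns - zs - t *\<^sub>R (adjoint (blinfun_apply (D2G v)) \<mu> + wk k))) \<le> \<rho> * e' * t"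
          by (rule order_trans[OF _ z(3)]) (metis norm_snd_le prod.collapse)
        show "norm (t *\<^sub>R (snd (wk k) - w)) \<le> t * e'"
          using k(1) t(1) by (simp add: dist_norm)
      qed
      finally have "norm (z - zb - t *\<^sub>R v) + norm (snd ns - xbs - t *\<^sub>R (D + w)) \<le> (\<rho> + 2) * e' * t"
        using z(2) by (simp add: algebra_simps)
      also have "(\<rho> + 2) * e' = e" using \<open>\<rho> \<ge> 0\<close> by (simp add: e'_def)
      finally have "norm ((z, snd ns) - (zb, xbs) - t *\<^sub>R (v, D + w)) \<le> e * t"
        using norm_Pair_le[of "z - zb - t *\<^sub>R v" "snd ns - xbs - t *\<^sub>R (D + w)"] by simp
      moreover have "(z, snd ns) \<in> gph_Psi g C"
        using regular_normal_cone_slice[OF z(1)] by (simp add: gph_Psi_def case_prod_beta)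
      ultimately show ?thesis by blast
    qed
    then show "\<exists>\<delta>>0. \<forall>t. 0 < t \<and> t < \<delta> \<longrightarrow>
        (\<exists>y\<in>gph_Psi g C. norm (y - (zb, xbs) - t *\<^sub>R (v, D + w)) \<le> e * t)"
      using \<open>\<delta> > 0\<close> by blast
  qed
  have "derivable_tangent (gph_Psi g C) (zb, xbs) (v, D + wx)"
    using wx_lim main unfolding fold by blast
  moreover have "(v, D + snd ws) \<in> tangent_cone (gph_Psi g C) (zb, xbs)"
    if "ws \<in> regular_normal_cone (critical_cone (gph_Gamma g C) zb zs) v" for ws
    using main[of "\<lambda>_. ws" "snd ws"] normal_to_critical_cone[OF that]
    by (simp add: derivable_tangent_def)
  ultimately show ?thesis
    unfolding fold Let_def D by (simp add: derivable_tangent_def)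
qed

end
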